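(* Let $d\ge 10$ be an integer, let $B_d\subset\mathbb{R}^d$ be the $d$-dimensional unit ball (either open or closed), and let $\tau(B_d)$ denote the minimal integer $m\ge 2$ such that $B_d$ is $m$-divisible. Then $$d<\tau(B_d)<20\cdot d.$$
   Context: For a cardinal number $m$, a set $K\subset\mathbb{R}^d$ is called $m$-divisible if $K$ can be decomposed into $m$ pairwise disjoint pieces which are congruent to each other, i.e. any two pieces are mapped onto each other by an isometry of $\mathbb{R}^d$ (an element of the full isometry group of $d$-dimensional Euclidean space). *)

theory Defs
  imports "HOL-Analysis.Analysis"
begin

text \<open>Elements of the full isometry group of the ambient space, orientation reversing ones included.\<close>

definition isometry :: "('a::metric_space \<Rightarrow> 'a) \<Rightarrow> bool" where
  "isometry f \<longleftrightarrow> bij f \<and> (\<forall>x y. dist (f x) (f y) = dist x y)"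

definition congruent_sets :: "'a::metric_space set \<Rightarrow> 'a set \<Rightarrow> bool" where
  "congruent_sets A B \<longleftrightarrow> (\<exists>f. isometry f \<and> f ` A = B)"

text \<open>The pieces are arbitrary nonempty sets; no measurability is required. The finiteness condition
  only excludes infinite families, whose \<^const>\<open>card\<close> is 0.\<close>

definition divisible_into :: "nat \<Rightarrow> 'a::metric_space set \<Rightarrow> bool" where
  "divisible_into m K \<longleftrightarrow>
     (\<exists>P. partition_on K P \<and> finite P \<and> card P = m \<and> (\<forall>A\<in>P. \<forall>B\<in>P. congruent_sets A B))"

text \<open>Only meaningful if \<open>K\<close> is \<open>m\<close>-divisible for some \<open>m \<ge> 2\<close>; otherwise the value is unspecified.\<close>

definition division_number :: "'a::metric_space set \<Rightarrow> nat" ("\<tau>") where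
  "\<tau> K = (LEAST m. m \<ge> 2 \<and> divisible_into m K)"

end

theory Submission
  imports Defs
begin

text \<open>Let \<open>d = CARD('n)\<close>. If the ball had at most \<open>d\<close> (and at least two) congruent pieces, let \<open>A\<close> be the
  piece of the centre. The congruences that carry \<open>A\<close> to the fewer than \<open>d\<close> other pieces move the centre
  to nonzero points, and some unit vector \<open>u\<close> is orthogonal to all of them. For \<open>t\<close> close to 1 the points
  \<open>t u\<close> and \<open>- t u\<close> are at distance more than 1 from these points, so they lie in \<open>A\<close>; but then another
  piece contains two points at distance \<open>2 t\<close> with midpoint away from the centre, and for \<open>t\<close> near 1 the
  ball has no room for them (\<open>not_divisible_into_few\<close>).

  For the upper bound it is enough to decompose the ball \<open>B\<close> into the images \<open>f\<^sub>i ` A\<close> of one set under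
  \<open>16 d + 1 < 20 d\<close> isometries. Join \<open>x \<in> B\<close> to \<open>y\<close> if \<open>x = f\<^sub>i y\<close> for some \<open>i\<close>, where only those \<open>y\<close> are
  admitted for which all \<open>f\<^sub>i y\<close> lie in \<open>B\<close>. The set \<open>A\<close> has to contain exactly one neighbour of each \<open>x\<close>. If
  all \<open>y\<close> on cycles are thrown away, the graph that remains is a forest, and there such a set exists as
  soon as every \<open>x\<close> keeps two neighbours; a single exceptional \<open>x\<close> may keep just one
  (\<open>forest_exact_cover\<close>, \<open>divisible_into_forest\<close>).

  All but one of the \<open>f\<^sub>i\<close> are rotations \<open>O\<^sub>i\<close> about the centre, and the last one is a rotation after a
  small translation by \<open>- \<epsilon> u\<close>. The centre is the exceptional point: its neighbours are \<open>\<epsilon> u\<close> and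
  itself, and the latter is on cycles, since all \<open>O\<^sub>i\<close> fix it. A
  point \<open>x\<close> is joined to an admitted point by \<open>O\<^sub>i\<close> if and only if \<open>x - \<epsilon> O\<^sub>i u \<in> B\<close>, which near the boundary
  means that \<open>x\<close> lies in a cap only slightly smaller than the half ball in direction \<open>O\<^sub>i u\<close>. The
  rotations are chosen near \<open>16 d\<close> explicit ones for which every \<open>x\<close> lies in four of these caps
  (\<open>exists_target_near\<close>). At most two of the corresponding neighbours of a point
  \<open>x \<noteq> 0\<close> are on cycles (\<open>few_cycles_at\<close>).

  The last claim, and the fact that \<open>\<epsilon> u\<close> is not on a cycle, say that the isometries satisfy no
  accidental relations. The space is split into blocks, each identified with the quaternions or with
  the purely imaginary ones, and the rotations multiply by unit quaternions, respectively conjugate with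
  them. These quaternions are proportional to \<open>(1 + s n) q\<close>, with \<open>n\<close> imaginary of norm 1 and \<open>q\<close> of
  norm 1 depending on \<open>i\<close> and on the block, and \<open>s\<close> a common real parameter. A relation between words
  is a polynomial equation in \<open>s\<close>, so it fails for all but finitely many \<open>s\<close> if it fails for one
  complex value; as there are countably many words, some small \<open>s\<close> avoids all
  relations (\<open>exists_good_parameter\<close>). The complex value is \<open>s = - \<i>\<close>: there \<open>1 + s n\<close> is a matrix of
  rank one, and products of such matrices can be read off from their first and last factors
  (\<open>wprod_at_minus_ii\<close>).

  Three relations matter. In three dimensions an affine isometry with linear part \<open>W \<noteq> 1\<close> has a
  fixed point only if its translation along the axis vanishes; this excludes cycles that use
  the screw motion. The same translation term shows that \<open>\<epsilon> u\<close> is on no cycle. Finally, two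
  rotations of a block that fix a common nonzero vector commute, and commuting words that start with
  different letters determine each other's last letter; so no three rotations can start words of
  rotations that fix the same \<open>x \<noteq> 0\<close>.\<close>

section \<open>Congruences and the lower bound\<close>

lemma isometry_comp: "isometry f \<Longrightarrow> isometry g \<Longrightarrow> isometry (f \<circ> g)"
  by (auto simp: isometry_def bij_comp)

lemma isometry_inv: 
  assumes "isometry f" shows "isometry (inv f)"
proof -
  have b: "bij f" using assms by (simp add: isometry_def)
  have "dist (inv f x) (inv f y) = dist x y" for x y
    using assms b by (metis isometry_def bij_inv_eq_iff)
  then show ?thesis using b by (simp add: isometry_def bij_imp_bij_inv)
qed

text \<open>The point \<open>c\<close> is the midpoint of \<open>p\<close> and \<open>q\<close>, because equality holds in the triangle
  inequality; the rest is the parallelogram law.\<close>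

lemma midpoint_bound:
  fixes p q c :: "'a::real_inner"
  assumes "dist p c = t" "dist q c = t" "dist p q = 2 * t" "norm p \<le> 1" "norm q \<le> 1"
  shows "t\<^sup>2 + (norm c)\<^sup>2 \<le> 1"
proof -
  define v w where "v = p - c" and "w = q - c"
  have nv: "(norm v)\<^sup>2 = t\<^sup>2" "(norm w)\<^sup>2 = t\<^sup>2"
    using assms by (simp_all add: v_def w_def dist_norm)
  have "v - w = p - q" by (simp add: v_def w_def)
  then have nd: "(norm (v - w))\<^sup>2 = 4 * t\<^sup>2"
    using assms(3) by (simp add: dist_norm power_mult_distrib)
  have par: "(norm (v + w))\<^sup>2 + (norm (v - w))\<^sup>2 = 2 * (norm v)\<^sup>2 + 2 * (norm w)\<^sup>2"
    by (simp add: power2_norm_eq_inner algebra_simps inner_commute)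
  have "(norm (v + w))\<^sup>2 = 0" using par nv nd by simp
  then have "w = - v" by (simp add: add_eq_0_iff)
  then have pq: "p = c + v" "q = c - v" by (auto simp: v_def w_def algebra_simps)
  have "(norm p)\<^sup>2 + (norm q)\<^sup>2 = 2 * (norm c)\<^sup>2 + 2 * (norm v)\<^sup>2"
    unfolding pq by (simp add: power2_norm_eq_inner algebra_simps inner_commute)
  moreover have "(norm p)\<^sup>2 \<le> 1" "(norm q)\<^sup>2 \<le> 1"
    using assms by (simp_all add: abs_square_le_1)
  ultimately show ?thesis using nv by simp
qed

text \<open>The bound on the number of pieces enters only through the existence of a direction
  orthogonal to all images of the centre.\<close>

lemma not_divisible_into_few:
  fixes B :: "'a::euclidean_space set"
  assumes B: "ball 0 1 \<subseteq> B" "B \<subseteq> cball 0 1" and m: "2 \<le> m" "m \<le> DIM('a)"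
  shows "\<not> divisible_into m B"
proof
  assume "divisible_into m B"
  then obtain P where P: "partition_on B P" "finite P" "card P = m"
    and cong: "\<forall>A\<in>P. \<forall>A'\<in>P. congruent_sets A A'"
    unfolding divisible_into_def by blast
  have UP: "\<Union>P = B" using P(1) by (simp add: partition_on_def)
  have "0 \<in> B" using B(1) by (force simp: ball_def)
  then obtain A1 where A1: "A1 \<in> P" "0 \<in> A1" using UP by blast
  have "\<forall>A\<in>P. \<exists>f. isometry f \<and> f ` A1 = A"
    using cong A1 by (auto simp: congruent_sets_def)
  then obtain f where f: "\<And>A. A \<in> P \<Longrightarrow> isometry (f A)" "\<And>A. A \<in> P \<Longrightarrow> f A ` A1 = A" by metis
  define C where "C = (\<lambda>A. f A 0) ` (P - {A1})"
  have finC: "finite C" using P(2) by (simp add: C_def)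
  have cardP: "card (P - {A1}) = m - 1" using P A1 by simp
  have ne: "f A 0 \<noteq> 0" if "A \<in> P - {A1}" for A
  proof
    assume "f A 0 = 0"
    then have "0 \<in> A" using f(2)[of A] A1 that by (metis DiffD1 image_eqI)
    then show False using that A1 P(1)
      by (auto simp: partition_on_def disjoint_def)
  qed
  have "dim C \<le> card C" using finC by (simp add: dim_le_card')
  also have "\<dots> \<le> m - 1" using card_image_le[of "P - {A1}" "\<lambda>A. f A 0"] P(2) cardP by (simp add: C_def)
  also have "\<dots> < DIM('a)" using m by simp
  finally obtain u0 where u0: "u0 \<noteq> 0" "\<And>y. y \<in> span C \<Longrightarrow> orthogonal u0 y"
    using orthogonal_to_subspace_exists by blast
  define u where "u = u0 /\<^sub>R norm u0"
  have nu: "norm u = 1" using u0 by (simp add: u_def)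
  have ou: "u \<bullet> c = 0" if "c \<in> C" for c
    using u0(2)[OF span_base[OF that]] by (simp add: u_def orthogonal_def)
  \<comment> \<open>Working with \<open>t < 1\<close> rather than on the sphere treats open and closed balls alike.\<close>
  have "\<exists>t::real. 0 < t \<and> t < 1 \<and> (\<forall>c\<in>C. t\<^sup>2 + (norm c)\<^sup>2 > 1)"
  proof -
    have "\<forall>\<^sub>F t::real in at_left 1. \<forall>c\<in>C. t\<^sup>2 + (norm c)\<^sup>2 > 1"
    proof (rule eventually_ball_finite[OF finC], rule ballI)
      fix c assume "c \<in> C"
      then have c0: "c \<noteq> 0" using ne by (auto simp: C_def)
      have "((\<lambda>t::real. t\<^sup>2 + (norm c)\<^sup>2) \<longlongrightarrow> 1\<^sup>2 + (norm c)\<^sup>2) (at_left 1)"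
        by (intro tendsto_intros)
      moreover have "1\<^sup>2 + (norm c)\<^sup>2 > (1::real)" using c0 by simp
      ultimately show "\<forall>\<^sub>F t::real in at_left 1. t\<^sup>2 + (norm c)\<^sup>2 > 1"
        by (rule order_tendstoD(1))
    qed
    moreover have "\<forall>\<^sub>F t::real in at_left 1. 0 < t \<and> t < 1"
      using eventually_at_left_real[of 0 "1::real"] by (auto elim!: eventually_mono)
    ultimately have "\<forall>\<^sub>F t::real in at_left 1. 0 < t \<and> t < 1 \<and> (\<forall>c\<in>C. t\<^sup>2 + (norm c)\<^sup>2 > 1)"
      by eventually_elim auto
    then show ?thesis using eventually_happens'[of "at_left (1::real)"] trivial_limit_at_left_real by blast
  qed
  then obtain t :: real where t: "0 < t" "t < 1" "\<And>c. c \<in> C \<Longrightarrow> t\<^sup>2 + (norm c)\<^sup>2 > 1" by blast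
  have inA1: "x \<in> A1" if x: "x = t *\<^sub>R u \<or> x = - (t *\<^sub>R u)" for x
  proof -
    have nx: "norm x = t" using x nu t by auto
    then have "x \<in> B" using B(1) t by (auto simp: subset_iff)
    then obtain A where A: "A \<in> P" "x \<in> A" using UP by blast
    show ?thesis
    proof (cases "A = A1")
      case False
      then have c: "f A 0 \<in> C" using A by (auto simp: C_def)
      obtain z where z: "z \<in> A1" "x = f A z" using f(2)[OF A(1)] A(2) by auto
      have "z \<in> B" using z A1 UP by blast
      then have "norm z \<le> 1" using B(2) by auto
      moreover have "dist x (f A 0) = norm z"
        using f(1)[OF A(1)] z(2) by (simp add: isometry_def)
      ultimately have "(norm (x - f A 0))\<^sup>2 \<le> 1" by (simp add: dist_norm abs_square_le_1)
      moreover have "x \<bullet> f A 0 = 0" using x ou[OF c] by auto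
      then have "(norm (x - f A 0))\<^sup>2 = (norm x)\<^sup>2 + (norm (f A 0))\<^sup>2"
        by (simp add: power2_norm_eq_inner algebra_simps inner_commute)
      ultimately show ?thesis using t(3)[OF c] nx by simp
    qed (use A in simp)
  qed
  have "P - {A1} \<noteq> {}" using cardP m by (metis card.empty diff_is_0_eq not_less_eq_eq numeral_2_eq_2 One_nat_def)
  then obtain A where A: "A \<in> P - {A1}" by blast
  then have AP: "A \<in> P" by simp
  have iso: "dist (f A x) (f A y) = dist x y" for x y using f(1)[OF AP] by (simp add: isometry_def)
  have nle: "norm (f A x) \<le> 1" if "x \<in> A1" for x
  proof -
    have "f A x \<in> A" using f(2)[OF AP] that by blast
    then have "f A x \<in> B" using AP UP by blast
    then show ?thesis using B(2) by auto
  qed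
  have "t\<^sup>2 + (norm (f A 0))\<^sup>2 \<le> 1"
  proof (rule midpoint_bound)
    show "dist (f A (t *\<^sub>R u)) (f A 0) = t" "dist (f A (- (t *\<^sub>R u))) (f A 0) = t"
      using iso t nu by simp_all
    have "t *\<^sub>R u - (- (t *\<^sub>R u)) = (2 * t) *\<^sub>R u" by (simp add: scaleR_2 [symmetric])
    then show "dist (f A (t *\<^sub>R u)) (f A (- (t *\<^sub>R u))) = 2 * t"
      using t nu by (subst iso) (simp add: dist_norm)
  qed (use nle inA1 in auto)
  then show False using t(3)[of "f A 0"] A by (force simp: C_def)
qed

section \<open>Exact covers of forests\<close>

text \<open>The bipartite graph has vertices \<open>x \<in> X\<close> and \<open>y\<close>, with \<open>N x\<close> the neighbours of \<open>x\<close>. The cycles that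
  have to be excluded may visit a vertex several times but never turn back on the spot, neither at the
  starting point.\<close>

definition closed_trail :: "('x \<Rightarrow> 'y set) \<Rightarrow> 'x set \<Rightarrow> nat \<Rightarrow> (nat \<Rightarrow> 'x) \<Rightarrow> (nat \<Rightarrow> 'y) \<Rightarrow> bool" where
  "closed_trail N X n x y \<longleftrightarrow> x (Suc n) = x 0 \<and> y n \<noteq> y 0 \<and>
     (\<forall>k\<le>n. x k \<in> X \<and> y k \<in> N (x k) \<inter> N (x (Suc k)) \<and> x k \<noteq> x (Suc k)) \<and>
     (\<forall>k<n. y k \<noteq> y (Suc k))"

definition trail :: "('x \<Rightarrow> 'y set) \<Rightarrow> 'x set \<Rightarrow> nat \<Rightarrow> (nat \<Rightarrow> 'x) \<Rightarrow> (nat \<Rightarrow> 'y) \<Rightarrow> bool" where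
  "trail N X n x y \<longleftrightarrow> inj_on x {..n} \<and> x ` {..n} \<subseteq> X \<and>
     (\<forall>k<n. y k \<in> N (x k) \<inter> N (x (Suc k))) \<and> (\<forall>k. Suc k < n \<longrightarrow> y k \<noteq> y (Suc k))"

definition shared :: "('x \<Rightarrow> 'y set) \<Rightarrow> 'x set \<Rightarrow> 'x \<Rightarrow> 'y set" where
  "shared N X x = {y \<in> N x. \<exists>x'\<in>X. x' \<noteq> x \<and> y \<in> N x'}"

text \<open>A longest trail in a forest ends in a leaf: a further neighbour of the last vertex would
  prolong the trail or close a cycle.\<close>

lemma trail_end_few_shared:
  assumes t: "trail N X n x y" and max: "\<And>x' y'. x' 0 = x 0 \<Longrightarrow> \<not> trail N X (Suc n) x' y'"
    and acyc: "\<And>n x y. \<not> closed_trail N X n x y"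
    and z: "z \<in> shared N X (x n)"
  shows "0 < n \<and> z = y (n - 1)"
proof (rule ccontr)
  assume neg: "\<not> (0 < n \<and> z = y (n - 1))"
  obtain x' where x': "x' \<in> X" "x' \<noteq> x n" "z \<in> N x'" and zn: "z \<in> N (x n)"
    using z by (auto simp: shared_def)
  show False
  proof (cases "\<exists>k<n. z \<in> N (x k)")
    case False
    then have new: "x' \<notin> x ` {..n}" using x' by (auto simp: le_less)
    have "trail N X (Suc n) (x(Suc n := x')) (y(n := z))"
      using t new x' zn neg
      by (auto simp: trail_def inj_on_def less_Suc_eq le_Suc_eq image_subset_iff)
    then show False using max[of "x(Suc n := x')"] by simp
  next
    case True
    \<comment> \<open>Closing up at the last possible vertex makes the cycle free of reversals.\<close>
    define k where "k = (GREATEST k. k < n \<and> z \<in> N (x k))"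
    have k: "k < n" "z \<in> N (x k)" 
      using GreatestI_ex_nat[of "\<lambda>k. k < n \<and> z \<in> N (x k)" n] True by (auto simp: k_def)
    have kmax: "j \<le> k" if "j < n" "z \<in> N (x j)" for j
      unfolding k_def using that by (intro Greatest_le_nat[of "\<lambda>k. k < n \<and> z \<in> N (x k)" _ n]) auto
    have yz: "y j \<noteq> z" if "k \<le> j" "j < n" for j
    proof (cases "Suc j = n")
      case True
      then show ?thesis using neg by auto
    next
      case False
      then have "Suc j < n" using that by simp
      then have "z \<notin> N (x (Suc j))" using kmax[of "Suc j"] that by auto
      then show ?thesis using t that by (auto simp: trail_def)
    qed
    have inj: "x i \<noteq> x j" if "i \<noteq> j" "i \<le> n" "j \<le> n" for i j
      using t that by (auto simp: trail_def inj_on_def)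
    have "closed_trail N X (n - k) (\<lambda>j. if j = Suc (n - k) then x k else x (k + j))
        (\<lambda>j. if j = n - k then z else y (k + j))"
      unfolding closed_trail_def
    proof (intro conjI allI impI)
      fix j assume j: "j \<le> n - k"
      show "(if j = Suc (n - k) then x k else x (k + j)) \<in> X"
        using j t k by (auto simp: trail_def)
      show "(if j = Suc (n - k) then x k else x (k + j)) \<noteq> 
            (if Suc j = Suc (n - k) then x k else x (k + Suc j))"
        using j k inj[of n k] inj[of "k + j" "Suc (k + j)"] by auto
      show "(if j = n - k then z else y (k + j))
         \<in> N (if j = Suc (n - k) then x k else x (k + j)) \<inter>
            N (if Suc j = Suc (n - k) then x k else x (k + Suc j))"
        using j k zn t by (auto simp: trail_def)
    next
      fix j assume j: "j < n - k"
      show "(if j = n - k then z else y (k + j)) \<noteq> (if Suc j = n - k then z else y (k + Suc j))"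
        using j k t yz[of "k + j"] by (auto simp: trail_def)
    qed (use k yz in auto)
    then show False using acyc by blast
  qed
qed

text \<open>The trail starts in \<open>r\<close> if possible, so that its end is different from \<open>r\<close> unless \<open>r\<close> is
  isolated. This is what allows \<open>r\<close> to have a single neighbour.\<close>

lemma exists_leaf:
  assumes "finite X" "X \<noteq> {}" and acyc: "\<And>n x y. \<not> closed_trail N X n x y"
  shows "\<exists>x\<in>X. (x = r \<longrightarrow> shared N X x = {}) \<and> (\<exists>z. shared N X x \<subseteq> {z})"
proof -
  obtain x0 where x0: "x0 \<in> X" "r \<in> X \<Longrightarrow> x0 = r" using assms(2) by (metis ex_in_conv)
  define S where "S = {n. \<exists>x y. x 0 = x0 \<and> trail N X n x y}"
  have "n \<le> card X" if nS: "n \<in> S" for n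
  proof -
    obtain x y where "trail N X n x y" using nS unfolding S_def by blast
    then have "card {..n} \<le> card X"
      using assms(1) by (intro card_inj_on_le[of x]) (auto simp: trail_def)
    then show ?thesis by simp
  qed
  moreover have "0 \<in> S" using x0 by (auto simp: S_def trail_def intro!: exI[of _ "\<lambda>_. x0"])
  ultimately have "\<exists>n. n \<in> S \<and> (\<forall>m\<in>S. m \<le> n)"
    using GreatestI_nat[of "\<lambda>n. n \<in> S" 0 "card X"] Greatest_le_nat[of "\<lambda>n. n \<in> S" _ "card X"] by blast
  then obtain n where n: "n \<in> S" "Suc n \<notin> S" by (metis not_less_eq_eq order_refl)
  then obtain x y where xy: "x 0 = x0" "trail N X n x y" by (auto simp: S_def)
  have few: "0 < n \<and> z = y (n - 1)" if "z \<in> shared N X (x n)" for z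
    by (rule trail_end_few_shared[OF xy(2) _ acyc that]) (use n xy in \<open>auto simp: S_def\<close>)
  have "x n \<in> X" using xy by (auto simp: trail_def)
  moreover have "shared N X (x n) = {}" if "x n = r"
  proof -
    have "x n = x 0" using that x0 xy \<open>x n \<in> X\<close> by simp
    then have "n = 0" using xy(2) by (auto simp: trail_def inj_on_def)
    then show ?thesis using few by blast
  qed
  ultimately show ?thesis using few by blast
qed

text \<open>A leaf \<open>x\<close> is removed and the cover of the remaining points is corrected on those neighbours
  of \<open>x\<close> that no other point sees: all of them are removed, and one is put back if \<open>x\<close> is not yet covered.
  A leaf different from \<open>r\<close> has such a private neighbour because only one of its neighbours is shared.\<close>

lemma finite_exact_cover:
  assumes "finite X" and acyc: "\<And>n x y. \<not> closed_trail N X n x y"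
    and two: "\<And>x. x \<in> X \<Longrightarrow> x \<noteq> r \<Longrightarrow> \<exists>y\<in>N x. \<exists>y'\<in>N x. y \<noteq> y'"
    and root: "r \<in> X \<Longrightarrow> N r \<noteq> {}"
  shows "\<exists>S. \<forall>x\<in>X. \<exists>!y. y \<in> N x \<inter> S"
  using assms
proof (induction "card X" arbitrary: X)
  case 0
  then show ?case by auto
next
  case (Suc n)
  then have "X \<noteq> {}" by auto
  from exists_leaf[OF Suc.prems(1) this Suc.prems(2)]
  obtain x z where x: "x \<in> X" "x = r \<Longrightarrow> shared N X x = {}" "shared N X x \<subseteq> {z}" by blast
  define Y where "Y = X - {x}"
  have noc: "\<not> closed_trail N Y n x' y'" for n x' y'
    using Suc.prems(2)[of n x' y'] by (auto simp: closed_trail_def Y_def)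
  have "\<exists>S. \<forall>x\<in>Y. \<exists>!y. y \<in> N x \<inter> S"
  proof (rule Suc.hyps(1))
    show "n = card Y" "finite Y" using Suc.hyps(2) Suc.prems(1) x by (auto simp: Y_def)
    show "\<And>x. x \<in> Y \<Longrightarrow> x \<noteq> r \<Longrightarrow> \<exists>y\<in>N x. \<exists>y'\<in>N x. y \<noteq> y'" using Suc.prems(3) by (auto simp: Y_def)
    show "r \<in> Y \<Longrightarrow> N r \<noteq> {}" using Suc.prems(4) by (auto simp: Y_def)
  qed (rule noc)
  then obtain S where S: "\<forall>x\<in>Y. \<exists>!y. y \<in> N x \<inter> S" by blast
  obtain p where p: "p \<in> N x" "p \<notin> shared N X x"
  proof (cases "x = r")
    case True
    then show ?thesis using Suc.prems(4) x that by auto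
  next
    case False
    then show ?thesis using Suc.prems(3)[OF x(1)] x(3) that by blast
  qed
  define S' where "S' = (S - (N x - shared N X x)) \<union> (if shared N X x \<inter> S = {} then {p} else {})"
  have same: "N x' \<inter> S' = N x' \<inter> S" if "x' \<in> Y" for x'
  proof -
    have "N x' \<inter> N x \<subseteq> shared N X x" using that by (auto simp: shared_def Y_def)
    then show ?thesis using p by (auto simp: S'_def)
  qed
  have "\<exists>!y. y \<in> N x \<inter> S'"
  proof (cases "shared N X x \<inter> S = {}")
    case True
    then have "N x \<inter> S' = {p}" using p by (auto simp: S'_def)
    then show ?thesis by auto
  next
    case False
    have "shared N X x \<subseteq> N x" by (auto simp: shared_def)
    then have "N x \<inter> S' = {z}" using False x(3) by (auto simp: S'_def)
    then show ?thesis by auto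
  qed
  moreover have "\<exists>!y. y \<in> N x' \<inter> S'" if "x' \<in> Y" for x'
    unfolding same[OF that] using S that by blast
  ultimately have "\<exists>!y. y \<in> N x' \<inter> S'" if "x' \<in> X" for x'
  proof (cases "x' = x")
    case False
    then have "x' \<in> Y" using that by (simp add: Y_def)
    then show ?thesis by fact
  qed (use \<open>\<exists>!y. y \<in> N x \<inter> S'\<close> in simp)
  then show ?case by blast
qed

text \<open>For finite \<open>N x\<close> the condition at \<open>x\<close> depends on finitely many coordinates of the indicator
  function, so it is closed in the compact product topology.\<close>

lemma exact_cover_compactness:
  fixes N :: "'x \<Rightarrow> 'y set"
  assumes fin: "\<And>x. x \<in> X \<Longrightarrow> finite (N x)"
    and loc: "\<And>X0. finite X0 \<Longrightarrow> X0 \<subseteq> X \<Longrightarrow> \<exists>S. \<forall>x\<in>X0. \<exists>!y. y \<in> N x \<inter> S"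
  shows "\<exists>S. \<forall>x\<in>X. \<exists>!y. y \<in> N x \<inter> S"
proof -
  define T :: "('y \<Rightarrow> bool) topology" where "T = product_topology (\<lambda>_. discrete_topology UNIV) UNIV"
  have top: "topspace T = UNIV" by (simp add: T_def topspace_product_topology)
  have comp: "compact_space T"
    by (simp add: T_def compact_space_product_topology compact_space_discrete_topology)
  have coord: "closedin T {S. S y = b}" for y b
  proof -
    have "continuous_map T (discrete_topology UNIV) (\<lambda>S. S y)"
      unfolding T_def by (rule continuous_map_product_projection) simp
    then have "closedin T {S \<in> topspace T. S y \<in> {b}}"
      by (rule closedin_continuous_map_preimage) simp
    then show ?thesis by (simp add: top)
  qed
  define K where "K x = {S. \<exists>!y. y \<in> N x \<and> S y}" for x
  have closed: "closedin T (K x)" if "x \<in> X" for x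
  proof -
    have *: "K x = (\<Union>y\<in>N x. {S. S y = True} \<inter> (\<Inter>y'\<in>N x. if y' = y then UNIV else {S. S y' = False}))"
      by (auto simp: K_def split: if_splits)
    have "closedin T ({S. S y = True} \<inter> (\<Inter>y'\<in>N x. if y' = y then UNIV else {S. S y' = False}))"
      if "y \<in> N x" for y
    proof (intro closedin_Int coord closedin_INT)
      show "N x \<noteq> {}" using that by blast
      show "closedin T (if y' = y then UNIV else {S. S y' = False})" for y'
        using coord[of y' False] closedin_topspace[of T] by (simp add: top)
    qed
    then show ?thesis unfolding * using fin[OF that] by (intro closedin_Union) auto
  qed
  have "\<Inter>(K ` X) \<noteq> {}"
  proof (rule comp[unfolded compact_space_fip, rule_format], intro conjI allI impI ballI)
    fix C assume "C \<in> K ` X"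
    then show "closedin T C" using closed by auto
  next
    fix F assume "finite F \<and> F \<subseteq> K ` X"
    then obtain X0 where X0: "X0 \<subseteq> X" "finite X0" "F = K ` X0" by (meson finite_subset_image)
    obtain S where "\<forall>x\<in>X0. \<exists>!y. y \<in> N x \<inter> S" using loc[OF X0(2,1)] by (elim exE)
    then have "(\<lambda>y. y \<in> S) \<in> \<Inter>F" unfolding X0(3) K_def by simp
    then show "\<Inter>F \<noteq> {}" by blast
  qed
  then obtain S where "S \<in> \<Inter>(K ` X)" by blast
  then have "\<forall>x\<in>X. \<exists>!y. y \<in> N x \<inter> Collect S" unfolding K_def by simp
  then show ?thesis by blast
qed

lemma forest_exact_cover:
  assumes "\<And>x. x \<in> X \<Longrightarrow> finite (N x)" and acyc: "\<And>n x y. \<not> closed_trail N X n x y"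
    and two: "\<And>x. x \<in> X \<Longrightarrow> x \<noteq> r \<Longrightarrow> \<exists>y\<in>N x. \<exists>y'\<in>N x. y \<noteq> y'"
    and root: "r \<in> X \<Longrightarrow> N r \<noteq> {}"
  shows "\<exists>S. \<forall>x\<in>X. \<exists>!y. y \<in> N x \<inter> S"
proof (rule exact_cover_compactness[OF assms(1)])
  fix X0 assume X0: "finite X0" "X0 \<subseteq> X"
  show "\<exists>S. \<forall>x\<in>X0. \<exists>!y. y \<in> N x \<inter> S"
  proof (rule finite_exact_cover[where r = r])
    show "\<not> closed_trail N X0 n x y" for n x y
      using acyc[of n x y] X0 by (auto simp: closed_trail_def)
  qed (use X0 two root in auto)
qed

section \<open>Words, cycles and congruent decompositions\<close>

type_synonym 'l word = "('l \<times> 'l) list"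

text \<open>The pair \<open>(a, b)\<close> stands for \<open>f\<^sub>a f\<^sub>b\<^sup>-\<^sup>1\<close>, the passage from a point to another point with a common
  neighbour. The last pair of a word acts first.\<close>

fun walk :: "('l \<Rightarrow> 'p \<Rightarrow> 'p) \<Rightarrow> 'l word \<Rightarrow> 'p \<Rightarrow> 'p" where
  "walk f [] x = x"
| "walk f ((a, b) # ws) x = f a (inv (f b) (walk f ws x))"

definition reduced :: "'l word \<Rightarrow> bool" where
  "reduced ws \<longleftrightarrow> (\<forall>p\<in>set ws. fst p \<noteq> snd p) \<and> successively (\<lambda>p q. snd p \<noteq> fst q) ws"

definition cyclic :: "'l word \<Rightarrow> bool" where
  "cyclic ws \<longleftrightarrow> ws \<noteq> [] \<and> reduced ws \<and> snd (last ws) \<noteq> fst (hd ws)"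

definition letters :: "'l word \<Rightarrow> 'l set" where
  "letters ws = fst ` set ws \<union> snd ` set ws"

text \<open>The cycle starts at \<open>y\<close> and first moves to its image under the last letter of the word.\<close>

definition cycle_at :: "('l \<Rightarrow> 'p \<Rightarrow> 'p) \<Rightarrow> 'l word \<Rightarrow> 'p \<Rightarrow> bool" where
  "cycle_at f ws y \<longleftrightarrow> cyclic ws \<and> walk f ws (f (snd (last ws)) y) = f (snd (last ws)) y"

lemma walk_append: "walk f (us @ vs) x = walk f us (walk f vs x)"
  by (induction us) auto

lemma walk_reverse:
  assumes "\<And>i. bij (f i)"
  shows "walk f (rev (map prod.swap ws)) (walk f ws x) = x"
proof (induction ws)
  case (Cons p ws)
  obtain a b where "p = (a, b)" by force
  then show ?case using Cons assms
    by (simp add: walk_append bij_is_inj bij_is_surj surj_f_inv_f)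
qed simp

lemma reduced_Nil: "reduced []"
  by (simp add: reduced_def)

lemma reduced_Cons:
  "reduced (p # ws) \<longleftrightarrow> fst p \<noteq> snd p \<and> reduced ws \<and> (ws \<noteq> [] \<longrightarrow> snd p \<noteq> fst (hd ws))"
  by (auto simp: reduced_def successively_Cons)

lemma reduced_append:
  "reduced (us @ vs) \<longleftrightarrow> reduced us \<and> reduced vs \<and>
     (us \<noteq> [] \<longrightarrow> vs \<noteq> [] \<longrightarrow> snd (last us) \<noteq> fst (hd vs))"
  by (auto simp: reduced_def successively_append_iff)

lemma reduced_reverse: "reduced (rev (map prod.swap ws)) \<longleftrightarrow> reduced ws"
proof (induction ws)
  case (Cons p ws)
  then show ?case
    by (cases p) (auto simp: reduced_append reduced_Cons reduced_Nil last_rev hd_map)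
qed simp

lemma letters_reverse: "letters (rev (map prod.swap ws)) = letters ws"
  by (force simp: letters_def image_iff)

text \<open>If \<open>y\<close> is on a cycle, one can go from \<open>f\<^sub>i y\<close> to \<open>y\<close>, around the cycle, and back. If \<open>i\<close> is one of the
  two letters by which the cycle passes through \<open>y\<close>, the path is shortened, and in one of these cases
  the cycle has to be run through backwards.\<close>

lemma cycle_at_return:
  assumes bij: "\<And>i. bij (f i)" and cyc: "cycle_at f ws y"
  shows "\<exists>vs. vs \<noteq> [] \<and> reduced vs \<and> fst (hd vs) = i \<and> letters vs \<subseteq> insert i (letters ws) \<and>
    walk f vs (f i y) = f i y"
proof -
  have inv: "inv (f i) (f i z) = z" for i z using bij by (simp add: bij_is_inj)
  have "ws \<noteq> []" using cyc by (simp add: cycle_at_def cyclic_def)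
  then obtain us a b where ws: "ws = us @ [(a, b)]" by (metis rev_exhaust surj_pair)
  have red: "reduced us" "a \<noteq> b" "us \<noteq> [] \<Longrightarrow> snd (last us) \<noteq> a" "us \<noteq> [] \<Longrightarrow> b \<noteq> fst (hd us)"
    using cyc by (auto simp: cycle_at_def cyclic_def ws reduced_append reduced_Cons hd_append split: if_splits)
  have fixed: "walk f us (f a y) = f b y"
    using cyc by (simp add: cycle_at_def ws walk_append inv)
  consider "i = b" | "i \<noteq> b" "i = a" | "i \<noteq> b" "i \<noteq> a" by blast
  then show ?thesis
  proof cases
    case 1
    have "walk f (rev (map prod.swap ws)) (walk f ws (f i y)) = f i y" by (rule walk_reverse[OF bij])
    moreover have "walk f ws (f i y) = f i y" using cyc by (simp add: cycle_at_def ws 1)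
    moreover have "fst (hd (rev (map prod.swap ws))) = i" by (simp add: ws 1)
    moreover have "reduced (rev (map prod.swap ws))"
      using cyc by (simp add: reduced_reverse cycle_at_def cyclic_def)
    ultimately show ?thesis using \<open>ws \<noteq> []\<close>
      by (intro exI[of _ "rev (map prod.swap ws)"]) (simp add: letters_reverse subset_insertI)
  next
    case 2
    then show ?thesis using red fixed
      by (intro exI[of _ "(i, b) # us"]) (auto simp: reduced_Cons letters_def ws inv)
  next
    case 3
    then show ?thesis using red fixed
      by (intro exI[of _ "(i, b) # us @ [(a, i)]"])
        (auto simp: reduced_Cons reduced_append reduced_Nil letters_def ws inv walk_append hd_append)
  qed
qed

lemma closed_trail_cycle:
  assumes bij: "\<And>i. bij (f i)" and N: "\<And>x y. y \<in> N x \<Longrightarrow> \<exists>i. f i y = x"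
    and t: "closed_trail N X n x y"
  shows "\<exists>ws. cycle_at f ws (y 0)"
proof -
  have inj: "f i z = f i z' \<longleftrightarrow> z = z'" for i z z' using bij by (simp add: bij_is_inj inj_eq)
  have inv: "inv (f i) (f i z) = z" for i z using bij by (simp add: bij_is_inj)
  have mem: "y k \<in> N (x k)" "y k \<in> N (x (Suc k))" "x k \<noteq> x (Suc k)" if "k \<le> n" for k
    using t that unfolding closed_trail_def by blast+
  have step: "y k \<noteq> y (Suc k)" if "k < n" for k
    using t that unfolding closed_trail_def by blast
  have closing: "x (Suc n) = x 0" "y n \<noteq> y 0" using t unfolding closed_trail_def by blast+
  have "\<forall>k. \<exists>b. k \<le> n \<longrightarrow> f b (y k) = x k" "\<forall>k. \<exists>a. k \<le> n \<longrightarrow> f a (y k) = x (Suc k)"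
    using N[OF mem(1)] N[OF mem(2)] by blast+
  then obtain a b where ab: "\<And>k. k \<le> n \<Longrightarrow> f (b k) (y k) = x k" "\<And>k. k \<le> n \<Longrightarrow> f (a k) (y k) = x (Suc k)"
    by metis
  define ws where "ws k = rev (map (\<lambda>k. (a k, b k)) [0..<Suc k])" for k
  have hd: "hd (ws k) = (a k, b k)" "ws k \<noteq> []" "last (ws k) = (a 0, b 0)" for k
    by (simp_all add: ws_def hd_rev last_rev hd_map last_map del: upt_Suc)
  have ws_Suc: "ws (Suc k) = (a (Suc k), b (Suc k)) # ws k" for k by (simp add: ws_def)
  have ne: "a k \<noteq> b k" if "k \<le> n" for k
    using ab[OF that] mem(3)[OF that] by auto
  have ne': "b (Suc k) \<noteq> a k" if "k < n" for k
  proof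
    assume "b (Suc k) = a k"
    then have "f (a k) (y (Suc k)) = f (a k) (y k)"
      using ab(2)[of k] ab(1)[of "Suc k"] that by simp
    then show False using step[OF that] by (simp add: inj)
  qed
  have "reduced (ws k) \<and> walk f (ws k) (x 0) = x (Suc k)" if "k \<le> n" for k
    using that
  proof (induction k)
    case 0
    have "f (b 0) (y 0) = x 0" by (rule ab(1)) (rule le0)
    from this[symmetric] have "inv (f (b 0)) (x 0) = y 0" by (simp only: inv)
    moreover have "ws 0 = [(a 0, b 0)]" by (simp add: ws_def)
    moreover have "a 0 \<noteq> b 0" "f (a 0) (y 0) = x (Suc 0)" using ne ab(2) by blast+
    ultimately show ?case by (simp add: reduced_Cons reduced_Nil)
  next
    case (Suc k)
    have "f (b (Suc k)) (y (Suc k)) = x (Suc k)" by (rule ab(1)) (use Suc in simp)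
    from this[symmetric] have "inv (f (b (Suc k))) (x (Suc k)) = y (Suc k)" by (simp only: inv)
    with Suc show ?case using ne[of "Suc k"] ne'[of k] ab(2)[of "Suc k"]
      by (simp add: ws_Suc reduced_Cons hd)
  qed
  from this[OF order_refl] have "reduced (ws n)" "walk f (ws n) (x 0) = x 0"
    unfolding closing(1) by simp_all
  moreover have b0: "f (b 0) (y 0) = x 0" by (rule ab(1)) (rule le0)
  moreover have "b 0 \<noteq> a n"
  proof
    assume "b 0 = a n"
    moreover have "f (a n) (y n) = x 0" using ab(2)[OF order_refl] unfolding closing(1) .
    ultimately have "f (b 0) (y n) = f (b 0) (y 0)" using b0 by simp
    then show False using closing(2) by (simp add: inj)
  qed
  ultimately have "cycle_at f (ws n) (y 0)" unfolding cycle_at_def cyclic_def hd by (simp add: hd(2))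
  then show ?thesis by blast
qed

text \<open>The point \<open>r\<close> is the one that may keep a single neighbour. The neighbours of \<open>x\<close> obtained from
  different letters are different, since otherwise the common neighbour would be on a cycle of length one.\<close>

theorem divisible_into_forest:
  fixes f :: "'l::finite \<Rightarrow> 'p::metric_space \<Rightarrow> 'p"
  assumes iso: "\<And>i. isometry (f i)" and "B \<noteq> {}"
    and D: "D = {y. (\<forall>i. f i y \<in> B) \<and> \<not> (\<exists>ws. cycle_at f ws y)}"
    and two: "\<And>x. x \<in> B \<Longrightarrow> x \<noteq> r \<Longrightarrow> \<exists>i j. i \<noteq> j \<and> inv (f i) x \<in> D \<and> inv (f j) x \<in> D"
    and root: "r \<in> B \<Longrightarrow> \<exists>i. inv (f i) r \<in> D"
  shows "divisible_into CARD('l) B"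
proof -
  have bij: "bij (f i)" for i using iso by (simp add: isometry_def)
  have inv: "inv (f i) (f i z) = z" for i z using bij by (simp add: bij_is_inj)
  have inv': "f i (inv (f i) z) = z" for i z using bij by (simp add: bij_is_surj surj_f_inv_f)
  have distinct: "i = j" if "y \<in> D" "f i y = f j y" for i j y
  proof (rule ccontr)
    assume "i \<noteq> j"
    then have "cycle_at f [(i, j)] y"
      using that by (simp add: cycle_at_def cyclic_def reduced_Cons reduced_Nil inv)
    then show False using that by (auto simp: D)
  qed
  define N where "N x = {y \<in> D. \<exists>i. f i y = x}" for x
  have "\<exists>S. \<forall>x\<in>B. \<exists>!y. y \<in> N x \<inter> S"
  proof (rule forest_exact_cover[where r = r])
    fix x
    have "N x \<subseteq> range (\<lambda>i. inv (f i) x)"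
    proof
      fix y assume "y \<in> N x"
      then obtain i where "f i y = x" by (auto simp: N_def)
      then have "y = inv (f i) x" using inv by auto
      then show "y \<in> range (\<lambda>i. inv (f i) x)" by (rule range_eqI)
    qed
    then show "finite (N x)" by (rule finite_subset) simp
  next
    fix n x y
    show "\<not> closed_trail N B n x y"
    proof
      assume t: "closed_trail N B n x y"
      then have "y 0 \<in> D" by (auto simp: closed_trail_def N_def)
      moreover have "\<exists>ws. cycle_at f ws (y 0)"
        by (rule closed_trail_cycle[OF bij _ t]) (simp add: N_def)
      ultimately show False by (simp add: D)
    qed
  next
    fix x assume "x \<in> B" "x \<noteq> r"
    then obtain i j where ij: "i \<noteq> j" "inv (f i) x \<in> D" "inv (f j) x \<in> D" using two by blast
    then have "inv (f i) x \<in> N x" "inv (f j) x \<in> N x" using inv' by (auto simp: N_def)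
    moreover have "inv (f i) x \<noteq> inv (f j) x"
      using distinct[of "inv (f i) x" i j] ij inv'[of i x] inv'[of j x] by auto
    ultimately show "\<exists>y\<in>N x. \<exists>y'\<in>N x. y \<noteq> y'" by blast
  next
    assume "r \<in> B"
    then obtain i where "inv (f i) r \<in> D" using root by blast
    then have "inv (f i) r \<in> N r" using inv'[of i r] by (auto simp: N_def)
    then show "N r \<noteq> {}" by blast
  qed
  then obtain S where S: "\<And>x. x \<in> B \<Longrightarrow> \<exists>!y. y \<in> N x \<inter> S" by blast
  define A where "A = D \<inter> S"
  have AB: "f i y \<in> B" if "y \<in> A" for i y
  proof -
    have "y \<in> D" using that by (simp add: A_def)
    then show ?thesis unfolding D by blast
  qed
  have uniq: "i = j" if "y \<in> A" "y' \<in> A" "f i y = f j y'" for i j y y'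
  proof -
    have "y \<in> N (f i y) \<inter> S" "y' \<in> N (f i y) \<inter> S"
      using that(1,2) that(3)[symmetric] by (auto simp: A_def N_def)
    then have "y = y'" using S[OF AB[OF that(1), of i]] by blast
    then show ?thesis using that distinct[of y i j] by (simp add: A_def)
  qed
  have cover: "\<exists>i. x \<in> f i ` A" if "x \<in> B" for x
    using S[OF that] by (auto simp: N_def A_def)
  have "A \<noteq> {}" using cover \<open>B \<noteq> {}\<close> by blast
  then obtain z where z: "z \<in> A" by blast
  define P where "P = range (\<lambda>i. f i ` A)"
  have "i = j" if "f i ` A = f j ` A" for i j
  proof -
    have "f i z \<in> f j ` A" using that z by blast
    then show ?thesis using uniq z by auto
  qed
  then have "inj (\<lambda>i. f i ` A)" by (rule injI)
  then have "card P = CARD('l)" by (simp add: P_def card_image)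
  moreover have "partition_on B P"
    unfolding partition_on_def
  proof (intro conjI)
    show "\<Union>P = B" using cover AB by (auto simp: P_def)
    show "disjoint P"
    proof (rule disjointI)
      fix C C' assume C: "C \<in> P" "C' \<in> P" "C \<noteq> C'"
      then obtain i j where ij: "C = f i ` A" "C' = f j ` A" by (auto simp: P_def)
      then have "i \<noteq> j" using C by blast
      then have "f i y \<noteq> f j y'" if "y \<in> A" "y' \<in> A" for y y'
        using uniq[OF that] by blast
      then show "C \<inter> C' = {}" unfolding ij by blast
    qed
    show "{} \<notin> P" using z by (auto simp: P_def)
  qed
  moreover have "congruent_sets (f i ` A) (f j ` A)" for i j
  proof -
    have "isometry (f j \<circ> inv (f i))" by (intro isometry_comp isometry_inv iso)
    moreover have "(f j \<circ> inv (f i)) ` f i ` A = f j ` A" by (simp add: image_comp comp_def inv)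
    ultimately show ?thesis unfolding congruent_sets_def by blast
  qed
  ultimately show ?thesis unfolding divisible_into_def by (intro exI[of _ P]) (auto simp: P_def)
qed

section \<open>Complex two-by-two matrices\<close>

text \<open>The matrices are a ring under matrix multiplication, which makes the simplifier's ring
  laws available; they carry the quaternions at real and at complex parameters.\<close>

datatype mat2 = Mat2 (m11: complex) (m12: complex) (m21: complex) (m22: complex)

lemma mat2_eq_iff: "X = Y \<longleftrightarrow> m11 X = m11 Y \<and> m12 X = m12 Y \<and> m21 X = m21 Y \<and> m22 X = m22 Y"
  by (auto intro: mat2.expand)

instantiation mat2 :: ring_1
begin

definition "0 = Mat2 0 0 0 0"
definition "1 = Mat2 1 0 0 1"
definition "X + Y = Mat2 (m11 X + m11 Y) (m12 X + m12 Y) (m21 X + m21 Y) (m22 X + m22 Y)"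
definition "X - Y = Mat2 (m11 X - m11 Y) (m12 X - m12 Y) (m21 X - m21 Y) (m22 X - m22 Y)"
definition "- X = Mat2 (- m11 X) (- m12 X) (- m21 X) (- m22 X)"
definition "X * Y = Mat2 (m11 X * m11 Y + m12 X * m21 Y) (m11 X * m12 Y + m12 X * m22 Y)
  (m21 X * m11 Y + m22 X * m21 Y) (m21 X * m12 Y + m22 X * m22 Y)"

instance
  by standard
    (simp_all add: zero_mat2_def one_mat2_def plus_mat2_def minus_mat2_def uminus_mat2_def
      times_mat2_def mat2_eq_iff algebra_simps)

end

lemma mat2_entries [simp]:
  "m11 0 = 0" "m12 0 = 0" "m21 0 = 0" "m22 0 = 0"
  "m11 1 = 1" "m12 1 = 0" "m21 1 = 0" "m22 1 = 1"
  "m11 (X + Y) = m11 X + m11 Y" "m12 (X + Y) = m12 X + m12 Y"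
  "m21 (X + Y) = m21 X + m21 Y" "m22 (X + Y) = m22 X + m22 Y"
  "m11 (X - Y) = m11 X - m11 Y" "m12 (X - Y) = m12 X - m12 Y"
  "m21 (X - Y) = m21 X - m21 Y" "m22 (X - Y) = m22 X - m22 Y"
  "m11 (- X) = - m11 X" "m12 (- X) = - m12 X" "m21 (- X) = - m21 X" "m22 (- X) = - m22 X"
  "m11 (X * Y) = m11 X * m11 Y + m12 X * m21 Y" "m12 (X * Y) = m11 X * m12 Y + m12 X * m22 Y"
  "m21 (X * Y) = m21 X * m11 Y + m22 X * m21 Y" "m22 (X * Y) = m21 X * m12 Y + m22 X * m22 Y"
  by (simp_all add: zero_mat2_def one_mat2_def plus_mat2_def minus_mat2_def uminus_mat2_def
      times_mat2_def)

definition sc :: "complex \<Rightarrow> mat2 \<Rightarrow> mat2" where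
  "sc k X = Mat2 (k * m11 X) (k * m12 X) (k * m21 X) (k * m22 X)"

definition adj :: "mat2 \<Rightarrow> mat2" where
  "adj X = Mat2 (m22 X) (- m12 X) (- m21 X) (m11 X)"

definition det2 :: "mat2 \<Rightarrow> complex" where
  "det2 X = m11 X * m22 X - m12 X * m21 X"

definition tr2 :: "mat2 \<Rightarrow> complex" where
  "tr2 X = m11 X + m22 X"

lemma sc_entries [simp]:
  "m11 (sc k X) = k * m11 X" "m12 (sc k X) = k * m12 X"
  "m21 (sc k X) = k * m21 X" "m22 (sc k X) = k * m22 X"
  by (simp_all add: sc_def)

lemma adj_entries [simp]:
  "m11 (adj X) = m22 X" "m12 (adj X) = - m12 X" "m21 (adj X) = - m21 X" "m22 (adj X) = m11 X"
  by (simp_all add: adj_def)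

lemma sc_mult: "sc k X * Y = sc k (X * Y)" "X * sc k Y = sc k (X * Y)"
  by (simp_all add: mat2_eq_iff algebra_simps)

lemma sc_sc [simp]: "sc k (sc l X) = sc (k * l) X"
  by (simp add: mat2_eq_iff)

lemma sc_1 [simp]: "sc 1 X = X"
  by (simp add: mat2_eq_iff)

lemma sc_0 [simp]: "sc 0 X = 0"
  by (simp add: mat2_eq_iff)

lemma sc_cancel: "k \<noteq> 0 \<Longrightarrow> sc k X = sc k Y \<longleftrightarrow> X = Y"
  by (simp add: mat2_eq_iff)

lemma sc_add: "sc k (X + Y) = sc k X + sc k Y" "sc k (X - Y) = sc k X - sc k Y"
  by (simp_all add: mat2_eq_iff algebra_simps)

lemma adj_mult [simp]: "adj (X * Y) = adj Y * adj X"
  by (simp add: mat2_eq_iff algebra_simps)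

lemma mult_adj: "X * adj X = sc (det2 X) 1" "adj X * X = sc (det2 X) 1"
  by (simp_all add: mat2_eq_iff det2_def algebra_simps)

lemma mult_adj_assoc: "Y * X * adj X = sc (det2 X) Y" "Y * adj X * X = sc (det2 X) Y"
  by (simp_all add: mult.assoc mult_adj sc_mult)

lemma det2_mult [simp]: "det2 (X * Y) = det2 X * det2 Y"
  by (simp add: det2_def algebra_simps)

lemma det2_adj [simp]: "det2 (adj X) = det2 X"
  by (simp add: det2_def)

lemma det2_sc [simp]: "det2 (sc k X) = k\<^sup>2 * det2 X"
  by (simp add: det2_def power2_eq_square algebra_simps)

lemma tr2_diff_commutator: "tr2 (X * Y - Y * X) = 0"
  by (simp add: tr2_def algebra_simps)

lemma tr2_sc [simp]: "tr2 (sc k X) = k * tr2 X"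
  by (simp add: tr2_def algebra_simps)

lemma proportional_triples:
  fixes u :: "'a::field"
  assumes "u \<noteq> 0" "a1 * u = a * u1" "a2 * u = a * u2" "b1 * u = b * u1" "b2 * u = b * u2"
  shows "a1 * b2 = a2 * b1" "a1 * b = a * b1" "a2 * b = a * b2"
proof -
  have "a1 = a * u1 / u" "a2 = a * u2 / u" "b1 = b * u1 / u" "b2 = b * u2 / u"
    using assms by (simp_all add: nonzero_eq_divide_eq)
  then show "a1 * b2 = a2 * b1" "a1 * b = a * b1" "a2 * b = a * b2" by simp_all
qed

text \<open>Modulo scalars, a matrix commutes with \<open>X\<close> only if it is proportional to \<open>X\<close>.\<close>

lemma centralizer_commutative:
  assumes XA: "X * A = A * X" and XB: "X * B = B * X" and X: "tr2 X = 0" "X \<noteq> 0"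
  shows "A * B = B * A"
proof -
  have x: "m22 X = - m11 X" using X(1) by (simp add: tr2_def add_eq_0_iff)
  have cross: "m21 C * m12 X = m12 C * m21 X" "(m11 C - m22 C) * m12 X = m12 C * (2 * m11 X)"
    "(m11 C - m22 C) * m21 X = m21 C * (2 * m11 X)" if "X * C = C * X" for C
    using arg_cong[OF that, of m11] arg_cong[OF that, of m12] arg_cong[OF that, of m21]
    by (simp_all only: mat2_entries x) (simp_all add: algebra_simps)
  note A = cross[OF XA] and B = cross[OF XB]
  have "m11 X \<noteq> 0 \<or> m12 X \<noteq> 0 \<or> m21 X \<noteq> 0" using X x by (auto simp: mat2_eq_iff)
  then have "m12 A * m21 B = m21 A * m12 B \<and> m12 A * (m11 B - m22 B) = (m11 A - m22 A) * m12 B \<and>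
    m21 A * (m11 B - m22 B) = (m11 A - m22 A) * m21 B"
  proof (elim disjE)
    assume "m11 X \<noteq> 0"
    then have "2 * m11 X \<noteq> 0" by simp
    note t = proportional_triples[OF this A(2)[symmetric] A(3)[symmetric] B(2)[symmetric] B(3)[symmetric]]
    show ?thesis using t by simp
  next
    assume h: "m12 X \<noteq> 0"
    note t = proportional_triples[OF h A(1) A(2) B(1) B(2)]
    show ?thesis using t by (simp add: mult_ac)
  next
    assume h: "m21 X \<noteq> 0"
    note t = proportional_triples[OF h A(1)[symmetric] A(3) B(1)[symmetric] B(3)]
    show ?thesis using t by (simp add: mult_ac)
  qed
  then show ?thesis by (simp add: mat2_eq_iff algebra_simps)
qed

section \<open>Polynomial families of matrices\<close>

definition poly_fun :: "(complex \<Rightarrow> complex) \<Rightarrow> bool" where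
  "poly_fun g \<longleftrightarrow> (\<exists>p. \<forall>s. g s = poly p s)"

lemma poly_fun_const: "poly_fun (\<lambda>_. c)"
  unfolding poly_fun_def by (rule exI[of _ "[:c:]"]) simp

lemma poly_fun_id: "poly_fun (\<lambda>s. s)"
  unfolding poly_fun_def by (rule exI[of _ "[:0, 1:]"]) simp

lemma poly_fun_add: "poly_fun g \<Longrightarrow> poly_fun h \<Longrightarrow> poly_fun (\<lambda>s. g s + h s)"
  unfolding poly_fun_def by (metis poly_add)

lemma poly_fun_diff: "poly_fun g \<Longrightarrow> poly_fun h \<Longrightarrow> poly_fun (\<lambda>s. g s - h s)"
  unfolding poly_fun_def by (metis poly_diff)

lemma poly_fun_mult: "poly_fun g \<Longrightarrow> poly_fun h \<Longrightarrow> poly_fun (\<lambda>s. g s * h s)"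
  unfolding poly_fun_def by (metis poly_mult)

lemma poly_fun_minus: "poly_fun g \<Longrightarrow> poly_fun (\<lambda>s. - g s)"
  unfolding poly_fun_def by (metis poly_minus)

lemma poly_fun_finite_zeros:
  assumes "poly_fun g" "g s0 \<noteq> 0"
  shows "finite {s. g s = 0}"
proof -
  obtain p where p: "\<And>s. g s = poly p s" using assms by (auto simp: poly_fun_def)
  then have "p \<noteq> 0" using assms by auto
  then show ?thesis using poly_roots_finite p by simp
qed

definition poly_mat :: "(complex \<Rightarrow> mat2) \<Rightarrow> bool" where
  "poly_mat F \<longleftrightarrow> poly_fun (\<lambda>s. m11 (F s)) \<and> poly_fun (\<lambda>s. m12 (F s)) \<and>
     poly_fun (\<lambda>s. m21 (F s)) \<and> poly_fun (\<lambda>s. m22 (F s))"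

lemma poly_mat_const: "poly_mat (\<lambda>_. X)"
  by (simp add: poly_mat_def poly_fun_const)

lemma poly_mat_add: "poly_mat F \<Longrightarrow> poly_mat F' \<Longrightarrow> poly_mat (\<lambda>s. F s + F' s)"
  by (simp add: poly_mat_def poly_fun_add)

lemma poly_mat_diff: "poly_mat F \<Longrightarrow> poly_mat F' \<Longrightarrow> poly_mat (\<lambda>s. F s - F' s)"
  by (simp add: poly_mat_def poly_fun_diff)

lemma poly_mat_mult: "poly_mat F \<Longrightarrow> poly_mat F' \<Longrightarrow> poly_mat (\<lambda>s. F s * F' s)"
  by (simp add: poly_mat_def poly_fun_mult poly_fun_add)

lemma poly_mat_sc: "poly_fun g \<Longrightarrow> poly_mat F \<Longrightarrow> poly_mat (\<lambda>s. sc (g s) (F s))"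
  by (simp add: poly_mat_def poly_fun_mult)

lemma poly_mat_adj: "poly_mat F \<Longrightarrow> poly_mat (\<lambda>s. adj (F s))"
  by (simp add: poly_mat_def poly_fun_minus)

lemmas poly_mat_intros = poly_mat_const poly_mat_add poly_mat_diff poly_mat_mult poly_mat_sc
  poly_mat_adj poly_fun_id

lemma poly_mat_finite_zeros:
  assumes "poly_mat F" "F s0 \<noteq> 0"
  shows "finite {s. F s = 0}"
proof -
  have "\<exists>e. poly_fun (\<lambda>s. e (F s)) \<and> e (F s0) \<noteq> 0 \<and> e 0 = 0"
    using assms unfolding poly_mat_def mat2_eq_iff by (metis mat2_entries(1-4))
  then obtain e where e: "poly_fun (\<lambda>s. e (F s))" "e (F s0) \<noteq> 0" "e (0::mat2) = (0::complex)" by blast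
  have "{s. F s = 0} \<subseteq> {s. e (F s) = 0}" using e(3) by auto
  then show ?thesis using poly_fun_finite_zeros[OF e(1,2)] by (rule finite_subset)
qed

lemma poly_fun_tr2: "poly_mat F \<Longrightarrow> poly_fun (\<lambda>s. tr2 (F s))"
  by (simp add: poly_mat_def poly_fun_add tr2_def)

section \<open>Words in a pencil of quaternions\<close>

fun wprod :: "('l \<Rightarrow> mat2) \<Rightarrow> 'l word \<Rightarrow> mat2" where
  "wprod P [] = 1"
| "wprod P ((a, b) # ws) = P a * adj (P b) * wprod P ws"

text \<open>If \<open>f\<^sub>a\<close> acts on a three-dimensional block as the rotation given by \<open>P a\<close> followed by translation
  by \<open>c a\<close>, then a word acts as the rotation given by \<open>wprod P ws\<close> followed by translation by some vector
  \<open>t\<close>, and \<open>wshift c P ws\<close> is \<open>t * wprod P ws\<close> (twice the dual part of a dual quaternion of the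
  motion). Unlike \<open>t\<close>, it is polynomial in the data.\<close>

fun wshift :: "('l \<Rightarrow> mat2) \<Rightarrow> ('l \<Rightarrow> mat2) \<Rightarrow> 'l word \<Rightarrow> mat2" where
  "wshift c P [] = 0"
| "wshift c P ((a, b) # ws) =
     (c a * (P a * adj (P b)) - P a * adj (P b) * c b) * wprod P ws + P a * adj (P b) * wshift c P ws"

text \<open>Imaginary quaternions of norm 1 from one great circle; they suffice for the axes.\<close>

definition axis :: "complex \<Rightarrow> mat2" where
  "axis w = Mat2 0 w (- cnj w) 0"

text \<open>For real \<open>s\<close> this is, up to a positive factor, \<open>q a\<close> followed by the rotation about
  \<open>axis (w a)\<close> by an angle that depends on \<open>s\<close> only.\<close>

definition pencil :: "('l \<Rightarrow> complex) \<Rightarrow> ('l \<Rightarrow> mat2) \<Rightarrow> complex \<Rightarrow> 'l \<Rightarrow> mat2" where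
  "pencil w q s a = (1 + sc s (axis (w a))) * q a"

text \<open>The product of the column \<open>(1, \<gamma>)\<close> and the row \<open>(1, \<rho>)\<close>.\<close>

definition outer :: "complex \<Rightarrow> complex \<Rightarrow> mat2" where
  "outer \<gamma> \<rho> = Mat2 1 \<rho> \<gamma> (\<gamma> * \<rho>)"

text \<open>The row \<open>(1, \<rho>)\<close> times \<open>X\<close> times the column \<open>(1, \<gamma>)\<close>.\<close>

definition pairing :: "complex \<Rightarrow> mat2 \<Rightarrow> complex \<Rightarrow> complex" where
  "pairing \<rho> X \<gamma> = m11 X + m12 X * \<gamma> + \<rho> * m21 X + \<rho> * m22 X * \<gamma>"

text \<open>Two nonvanishing conditions, one for each way in which factors of rank one meet in a
  reduced word: at the junction of two pairs, and inside a pair.\<close>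

definition generic :: "('l \<Rightarrow> complex) \<Rightarrow> ('l \<Rightarrow> mat2) \<Rightarrow> bool" where
  "generic w q \<longleftrightarrow> (\<forall>a. cmod (w a) = 1) \<and>
     (\<forall>a b. a \<noteq> b \<longrightarrow> w a \<noteq> w b \<and> pairing (- \<i> * w a) (q a * adj (q b)) (- \<i> * cnj (w b)) \<noteq> 0)"

lemma outer_sandwich: "outer \<gamma> \<rho> * X * outer \<gamma>' \<rho>' = sc (pairing \<rho> X \<gamma>') (outer \<gamma> \<rho>')"
  by (simp add: mat2_eq_iff outer_def pairing_def algebra_simps)

lemma outer_mult: "outer \<gamma> \<rho> * outer \<gamma>' \<rho>' = sc (1 + \<rho> * \<gamma>') (outer \<gamma> \<rho>')"
  by (simp add: mat2_eq_iff outer_def algebra_simps)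

lemma unit_cnj: "cmod w = 1 \<Longrightarrow> w * cnj w = 1"
  by (simp add: complex_norm_square[symmetric])

lemma pencil_at_minus_ii:
  assumes "cmod w = 1"
  shows "1 + sc (- \<i>) (axis w) = outer (\<i> * cnj w) (- \<i> * w)"
    and "adj (1 + sc (- \<i>) (axis w)) = outer (- \<i> * cnj w) (\<i> * w)"
  using unit_cnj[OF assms] by (simp_all add: mat2_eq_iff axis_def outer_def algebra_simps)

lemma pencil_pair_at_minus_ii:
  assumes "generic w q"
  shows "pencil w q (- \<i>) a * adj (pencil w q (- \<i>) b) =
    sc (pairing (- \<i> * w a) (q a * adj (q b)) (- \<i> * cnj (w b))) (outer (\<i> * cnj (w a)) (\<i> * w b))"
proof -
  have "cmod (w a) = 1" "cmod (w b) = 1" using assms by (simp_all add: generic_def)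
  then have "pencil w q (- \<i>) a * adj (pencil w q (- \<i>) b) =
    outer (\<i> * cnj (w a)) (- \<i> * w a) * (q a * adj (q b)) * outer (- \<i> * cnj (w b)) (\<i> * w b)"
    by (simp only: pencil_def adj_mult pencil_at_minus_ii(2)) (simp only: pencil_at_minus_ii(1) mult.assoc)
  then show ?thesis by (simp only: outer_sandwich)
qed

lemma one_minus_unit_cnj:
  assumes "cmod v = 1" "cmod w = 1" "v \<noteq> w"
  shows "1 + \<i> * v * (\<i> * cnj w) \<noteq> 0"
proof
  assume "1 + \<i> * v * (\<i> * cnj w) = 0"
  then have "v * cnj w = 1" by (simp add: mult_ac)
  then have "v * (w * cnj w) = w" by (simp add: mult.commute mult.left_commute)
  then show False using unit_cnj[OF assms(2)] assms(3) by simp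
qed

text \<open>The factors of rank one collapse: only the column of the first letter and the row of the last
  letter survive, with a factor that genericity keeps away from zero.\<close>

lemma wprod_at_minus_ii:
  assumes g: "generic w q" and "ws \<noteq> []" "reduced ws"
  shows "\<exists>\<kappa>. \<kappa> \<noteq> 0 \<and> wprod (pencil w q (- \<i>)) ws =
    sc \<kappa> (outer (\<i> * cnj (w (fst (hd ws)))) (\<i> * w (snd (last ws))))"
  using assms(2,3)
proof (induction ws)
  case (Cons p ws)
  obtain a b where p: "p = (a, b)" by force
  have ab: "a \<noteq> b" using Cons.prems by (simp add: reduced_Cons p)
  define k where "k = pairing (- \<i> * w a) (q a * adj (q b)) (- \<i> * cnj (w b))"
  have k: "k \<noteq> 0" using g ab by (simp add: k_def generic_def)
  have G: "pencil w q (- \<i>) a * adj (pencil w q (- \<i>) b) = sc k (outer (\<i> * cnj (w a)) (\<i> * w b))"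
    unfolding k_def by (rule pencil_pair_at_minus_ii[OF g])
  show ?case
  proof (cases "ws = []")
    case True
    then show ?thesis using k by (intro exI[of _ k]) (simp add: p G)
  next
    case False
    then obtain \<kappa> where \<kappa>: "\<kappa> \<noteq> 0" "wprod (pencil w q (- \<i>)) ws =
        sc \<kappa> (outer (\<i> * cnj (w (fst (hd ws)))) (\<i> * w (snd (last ws))))"
      using Cons by (auto simp: reduced_Cons)
    have "b \<noteq> fst (hd ws)" using Cons.prems False by (simp add: reduced_Cons p)
    then have "1 + \<i> * w b * (\<i> * cnj (w (fst (hd ws)))) \<noteq> 0"
      using g by (intro one_minus_unit_cnj) (auto simp: generic_def)
    then show ?thesis using False k \<kappa>
      by (intro exI[of _ "k * (\<kappa> * (1 + \<i> * w b * (\<i> * cnj (w (fst (hd ws))))))"])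
        (simp add: p G sc_mult outer_mult mult_ac)
  qed
qed simp

lemma wprod_at_minus_ii_nonzero:
  assumes "generic w q" "ws \<noteq> []" "reduced ws"
  shows "wprod (pencil w q (- \<i>)) ws \<noteq> 0"
  using wprod_at_minus_ii[OF assms] by (auto simp: mat2_eq_iff outer_def)

text \<open>The trace pairs the last row with the first column, and cyclic reducedness is the condition
  that they do not annihilate each other.\<close>

lemma tr2_wprod_at_minus_ii:
  assumes g: "generic w q" and c: "cyclic ws"
  shows "tr2 (wprod (pencil w q (- \<i>)) ws) \<noteq> 0"
proof -
  have "1 + \<i> * w (snd (last ws)) * (\<i> * cnj (w (fst (hd ws)))) \<noteq> 0"
    using assms by (intro one_minus_unit_cnj) (auto simp: generic_def cyclic_def)
  moreover obtain \<kappa> where "\<kappa> \<noteq> 0" "wprod (pencil w q (- \<i>)) ws =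
        sc \<kappa> (outer (\<i> * cnj (w (fst (hd ws)))) (\<i> * w (snd (last ws))))"
    using wprod_at_minus_ii[OF g] c by (auto simp: cyclic_def)
  ultimately show ?thesis by (simp add: outer_def tr2_def mult_ac)
qed

text \<open>Matrices of rank one with different images commute only if their products vanish.\<close>

lemma commuting_at_minus_ii:
  assumes g: "generic w q" and us: "us \<noteq> []" "reduced us" and vs: "vs \<noteq> []" "reduced vs"
    and comm: "wprod (pencil w q (- \<i>)) us * wprod (pencil w q (- \<i>)) vs =
      wprod (pencil w q (- \<i>)) vs * wprod (pencil w q (- \<i>)) us"
    and ne: "fst (hd us) \<noteq> fst (hd vs)"
  shows "snd (last us) = fst (hd vs)"
proof (rule ccontr)
  assume last: "snd (last us) \<noteq> fst (hd vs)"
  define \<gamma> \<rho> \<gamma>' \<rho>' where "\<gamma> = \<i> * cnj (w (fst (hd us)))" and "\<rho> = \<i> * w (snd (last us))"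
    and "\<gamma>' = \<i> * cnj (w (fst (hd vs)))" and "\<rho>' = \<i> * w (snd (last vs))"
  obtain k where k: "k \<noteq> 0" "wprod (pencil w q (- \<i>)) us = sc k (outer \<gamma> \<rho>)"
    using wprod_at_minus_ii[OF g us] by (auto simp: \<gamma>_def \<rho>_def)
  obtain k' where k': "k' \<noteq> 0" "wprod (pencil w q (- \<i>)) vs = sc k' (outer \<gamma>' \<rho>')"
    using wprod_at_minus_ii[OF g vs] by (auto simp: \<gamma>'_def \<rho>'_def)
  have "sc (k * k' * (1 + \<rho> * \<gamma>')) (outer \<gamma> \<rho>') = sc (k * k' * (1 + \<rho>' * \<gamma>)) (outer \<gamma>' \<rho>)"
    using comm by (simp add: k k' sc_mult outer_mult mult_ac)
  then have "1 + \<rho> * \<gamma>' = 1 + \<rho>' * \<gamma>" "(1 + \<rho> * \<gamma>') * \<gamma> = (1 + \<rho>' * \<gamma>) * \<gamma>'"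
    using k(1) k'(1) by (auto simp: mat2_eq_iff outer_def)
  moreover have "\<gamma> \<noteq> \<gamma>'" using g ne by (auto simp: \<gamma>_def \<gamma>'_def generic_def)
  moreover have "1 + \<rho> * \<gamma>' \<noteq> 0"
    unfolding \<rho>_def \<gamma>'_def using g last by (intro one_minus_unit_cnj) (auto simp: generic_def)
  ultimately show False by simp
qed

text \<open>Letters are counted with multiplicity but without sign: the inverse screw motion contributes to
  the shift with the same sign as the screw motion, see \<open>wshift_at_minus_ii\<close>.\<close>

fun occurrences :: "'l \<Rightarrow> 'l word \<Rightarrow> nat" where
  "occurrences z [] = 0"
| "occurrences z ((a, b) # ws) = of_bool (a = z) + of_bool (b = z) + occurrences z ws"

lemma occurrences_pos: "z \<in> letters ws \<Longrightarrow> occurrences z ws > 0"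
proof (induction ws)
  case (Cons p ws)
  then have "z = fst p \<or> z = snd p \<or> z \<in> letters ws" by (auto simp: letters_def)
  then show ?case using Cons.IH by (cases p) auto
qed (simp add: letters_def)

text \<open>At \<open>s = - \<i>\<close> the column of the letter \<open>z\<close> is an eigenvector of its axis with eigenvalue \<open>\<i>\<close>, and the row
  of its inverse is an eigenvector with eigenvalue \<open>- \<i>\<close>. So the contributions of all occurrences
  of \<open>z\<close> are equal and cannot cancel.\<close>

lemma wshift_at_minus_ii:
  assumes g: "generic w q" and w: "w z = 1"
  shows "wshift (\<lambda>a. if a = z then sc h (axis 1) else 0) (pencil w q (- \<i>)) ws =
    sc (\<i> * h * of_nat (occurrences z ws)) (wprod (pencil w q (- \<i>)) ws)"
proof (induction ws)
  case (Cons p ws)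
  obtain a b where p: "p = (a, b)" by force
  define k where "k = pairing (- \<i> * w a) (q a * adj (q b)) (- \<i> * cnj (w b))"
  define G where "G = pencil w q (- \<i>) a * adj (pencil w q (- \<i>) b)"
  have G: "G = sc k (outer (\<i> * cnj (w a)) (\<i> * w b))"
    unfolding k_def G_def by (rule pencil_pair_at_minus_ii[OF g])
  have "axis 1 * G = sc \<i> G" if "a = z"
    using that w by (simp add: G mat2_eq_iff axis_def outer_def mult_ac)
  then have l: "(if a = z then sc h (axis 1) else 0) * G = sc (\<i> * h * of_nat (of_bool (a = z))) G"
    by (simp add: sc_mult mult_ac)
  have "G * axis 1 = sc (- \<i>) G" if "b = z"
    using that w by (simp add: G mat2_eq_iff axis_def outer_def mult_ac)
  then have r: "G * (if b = z then sc h (axis 1) else 0) = sc (- \<i> * h * of_nat (of_bool (b = z))) G"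
    by (simp add: sc_mult mult_ac)
  have "(if a = z then sc h (axis 1) else 0) * G - G * (if b = z then sc h (axis 1) else 0)
    = sc (\<i> * h * of_nat (of_bool (a = z) + of_bool (b = z))) G"
    unfolding l r by (simp add: mat2_eq_iff algebra_simps)
  then show ?case using Cons.IH
    by (simp only: p wshift.simps wprod.simps G_def[symmetric] occurrences.simps sc_mult of_nat_add)
      (simp add: mat2_eq_iff algebra_simps)
next
  case Nil
  then show ?case by (simp add: mat2_eq_iff)
qed

lemma poly_mat_pencil: "poly_mat (\<lambda>s. pencil w q s a)"
  unfolding pencil_def by (intro poly_mat_intros)

lemma poly_mat_wprod: "poly_mat (\<lambda>s. wprod (pencil w q s) ws)"
  by (induction ws) (auto intro!: poly_mat_intros poly_mat_pencil)

lemma poly_mat_wshift: "poly_mat (\<lambda>s. wshift c (pencil w q s) ws)"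
  by (induction ws) (auto intro!: poly_mat_intros poly_mat_pencil poly_mat_wprod)

section \<open>Choosing the axes\<close>

lemma greedy_choice:
  assumes "finite S" "infinite C" "v0 \<in> C"
    and exc: "\<And>a b v'. a \<noteq> b \<Longrightarrow> v' \<in> C \<Longrightarrow> finite {v \<in> C. \<not> (R a b v v' \<and> R b a v' v)}"
  shows "\<exists>w. (\<forall>a. w a \<in> C) \<and> w z = v0 \<and>
    (\<forall>a\<in>insert z S. \<forall>b\<in>insert z S. a \<noteq> b \<longrightarrow> R a b (w a) (w b))"
  using assms(1)
proof (induction S)
  case empty
  then show ?case using assms(3) by (intro exI[of _ "\<lambda>_. v0"]) auto
next
  case (insert c S)
  then obtain w where w: "\<And>a. w a \<in> C" "w z = v0"
    "\<And>a b. a \<in> insert z S \<Longrightarrow> b \<in> insert z S \<Longrightarrow> a \<noteq> b \<Longrightarrow> R a b (w a) (w b)" by blast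
  show ?case
  proof (cases "c = z")
    case True
    then show ?thesis using w by (intro exI[of _ w]) auto
  next
    case False
    have "finite (\<Union>b\<in>insert z S. {v \<in> C. \<not> (R c b v (w b) \<and> R b c (w b) v)})"
    proof (rule finite_UN_I)
      fix b assume "b \<in> insert z S"
      then have "c \<noteq> b" using insert.hyps False by blast
      then show "finite {v \<in> C. \<not> (R c b v (w b) \<and> R b c (w b) v)}" using exc w(1) by blast
    qed (use insert.hyps in simp)
    then have "\<not> C \<subseteq> (\<Union>b\<in>insert z S. {v \<in> C. \<not> (R c b v (w b) \<and> R b c (w b) v)})"
      using assms(2) finite_subset by blast
    then obtain v where v: "v \<in> C" "\<And>b. b \<in> insert z S \<Longrightarrow> R c b v (w b) \<and> R b c (w b) v" by blast
    show ?thesis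
      by (rule exI[of _ "w(c := v)"]) (use insert.hyps False w v in auto)
  qed
qed

lemma pairing_zeros_left:
  assumes "det2 X \<noteq> 0"
  shows "finite {v. pairing (- \<i> * v) X \<gamma> = 0}"
proof -
  define A B where "A = m11 X + m12 X * \<gamma>" and "B = m21 X + m22 X * \<gamma>"
  have eq: "pairing (- \<i> * v) X \<gamma> = A - \<i> * v * B" for v
    by (simp add: pairing_def A_def B_def algebra_simps)
  have "finite {v. A - \<i> * v * B = 0}"
  proof (cases "B = 0")
    case True
    have "det2 X = m22 X * A - m12 X * B" by (simp add: det2_def A_def B_def algebra_simps)
    then have "A \<noteq> 0" using True assms by auto
    then show ?thesis by (simp add: True)
  next
    case False
    then have "{v. A - \<i> * v * B = 0} \<subseteq> {A / (\<i> * B)}" by (auto simp: field_simps)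
    then show ?thesis by (rule finite_subset) simp
  qed
  then show ?thesis by (simp only: eq)
qed

lemma pairing_transpose:
  "pairing \<rho> X \<gamma> = pairing \<gamma> (Mat2 (m11 X) (m21 X) (m12 X) (m22 X)) \<rho>"
  by (simp add: pairing_def algebra_simps)

lemma pairing_zeros_right:
  assumes "det2 X \<noteq> 0"
  shows "finite {v. pairing \<rho> X (- \<i> * cnj v) = 0}"
proof -
  define Y where "Y = Mat2 (m11 X) (m21 X) (m12 X) (m22 X)"
  have "det2 Y \<noteq> 0" using assms by (simp add: Y_def det2_def mult.commute)
  from pairing_zeros_left[OF this, of \<rho>]
  have "finite (cnj -` {v. pairing (- \<i> * v) Y \<rho> = 0})" by (rule finite_vimageI) (simp add: inj_def)
  then show ?thesis by (simp add: vimage_def pairing_transpose[of \<rho> X] Y_def)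
qed

lemma infinite_unit_circle: "infinite {v::complex. cmod v = 1}"
proof
  assume fin: "finite {v::complex. cmod v = 1}"
  have "connected (sphere (0::complex) 1)" by (rule connected_sphere) simp
  moreover have "sphere (0::complex) 1 = {v. cmod v = 1}" by (auto simp: sphere_def)
  ultimately have "connected {v::complex. cmod v = 1}" by simp
  then obtain x where "{v::complex. cmod v = 1} = {} \<or> {v::complex. cmod v = 1} = {x}"
    using fin connected_finite_iff_sing by metis
  moreover have "1 \<in> {v::complex. cmod v = 1}" "- 1 \<in> {v::complex. cmod v = 1}" by simp_all
  ultimately show False by (metis empty_iff one_neq_neg_one singletonD)
qed

text \<open>The axes are chosen one letter after the other. Given the previous choices, each condition
  is a nontrivial linear equation in the new parameter or in its conjugate, so it excludes at most one
  point of the unit circle.\<close>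

lemma exists_generic:
  fixes q :: "'l::finite \<Rightarrow> mat2"
  assumes q: "\<And>a. det2 (q a) = 1"
  shows "\<exists>w. generic w q \<and> w z = 1"
proof -
  define C where "C = {v::complex. cmod v = 1}"
  define R where "R a b v v' \<longleftrightarrow> v \<noteq> v' \<and> pairing (- \<i> * v) (q a * adj (q b)) (- \<i> * cnj v') \<noteq> 0"
    for a b v v'
  have "finite {v \<in> C. \<not> (R a b v v' \<and> R b a v' v)}" for a b v'
  proof -
    have "{v \<in> C. \<not> (R a b v v' \<and> R b a v' v)} \<subseteq> {v'} \<union>
      {v. pairing (- \<i> * v) (q a * adj (q b)) (- \<i> * cnj v') = 0} \<union>
      {v. pairing (- \<i> * v') (q b * adj (q a)) (- \<i> * cnj v) = 0}" by (auto simp: R_def)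
    moreover have "finite \<dots>" by (intro finite_UnI pairing_zeros_left pairing_zeros_right) (simp_all add: q)
    ultimately show ?thesis by (rule finite_subset)
  qed
  then obtain w where w: "\<And>a. w a \<in> C" "w z = 1" "\<And>a b. a \<noteq> b \<Longrightarrow> R a b (w a) (w b)"
    using greedy_choice[of UNIV C 1 R z] infinite_unit_circle by (auto simp: C_def)
  then have "generic w q" by (simp add: generic_def C_def R_def)
  then show ?thesis using w(2) by blast
qed

section \<open>Quaternions acting on blocks of dimension three and four\<close>

definition quat :: "real \<Rightarrow> real \<Rightarrow> real \<Rightarrow> real \<Rightarrow> mat2" where
  "quat x0 x1 x2 x3 = Mat2 (Complex x0 x1) (Complex x2 x3) (Complex (- x2) x3) (Complex x0 (- x1))"

definition co :: "nat \<Rightarrow> mat2 \<Rightarrow> real" where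
  "co p X = (if p = 0 then Re (m11 X) else if p = 1 then Im (m11 X) else
     if p = 2 then Re (m12 X) else Im (m12 X))"

definition quaternion :: "mat2 \<Rightarrow> bool" where
  "quaternion X \<longleftrightarrow> m21 X = - cnj (m12 X) \<and> m22 X = cnj (m11 X)"

text \<open>Blocks of dimension three (\<open>im\<close> true) consist of imaginary quaternions, the others of all quaternions.\<close>

definition block :: "bool \<Rightarrow> mat2 \<Rightarrow> bool" where
  "block im X \<longleftrightarrow> quaternion X \<and> (im \<longrightarrow> tr2 X = 0)"

text \<open>Conjugation on imaginary quaternions, left multiplication otherwise. The determinant
  normalises quaternions \<open>P\<close> that need not have norm 1.\<close>

definition act :: "bool \<Rightarrow> mat2 \<Rightarrow> mat2 \<Rightarrow> mat2" where
  "act im P Y = (if im then sc (of_real (1 / Re (det2 P))) (P * Y * adj P)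
     else sc (of_real (1 / sqrt (Re (det2 P)))) (P * Y))"

lemma sum_lessThan_4: "(\<Sum>p<4. g p) = g 0 + g 1 + g 2 + g (3::nat)"
  for g :: "nat \<Rightarrow> real"
  by (simp add: eval_nat_numeral)

lemma quaternion_quat: "quaternion (quat x0 x1 x2 x3)"
  by (simp add: quaternion_def quat_def complex_eq_iff)

lemma quaternion_eqI:
  assumes "quaternion X" "quaternion Y" "\<And>p. p < 4 \<Longrightarrow> co p X = co p Y"
  shows "X = Y"
  using assms(1,2) assms(3)[of 0] assms(3)[of 1] assms(3)[of 2] assms(3)[of 3]
  by (simp add: quaternion_def co_def mat2_eq_iff complex_eq_iff)

lemma quaternion_mult: "quaternion X \<Longrightarrow> quaternion Y \<Longrightarrow> quaternion (X * Y)"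
  by (simp add: quaternion_def algebra_simps)

lemma quaternion_add: "quaternion X \<Longrightarrow> quaternion Y \<Longrightarrow> quaternion (X + Y)"
  by (simp add: quaternion_def algebra_simps)

lemma quaternion_adj: "quaternion X \<Longrightarrow> quaternion (adj X)"
  by (simp add: quaternion_def)

lemma quaternion_sc: "quaternion X \<Longrightarrow> quaternion (sc (of_real r) X)"
  by (simp add: quaternion_def)

lemma quaternion_1: "quaternion 1"
  by (simp add: quaternion_def)

lemma quaternion_axis: "quaternion (axis w)"
  by (simp add: quaternion_def axis_def)

lemma det2_quaternion:
  assumes "quaternion X"
  shows "det2 X = of_real (\<Sum>p<4. (co p X)\<^sup>2)"
  using assms
  by (simp add: sum_lessThan_4 co_def quaternion_def det2_def complex_eq_iff power2_eq_square)

lemma det2_quaternion_eq_0: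
  assumes "quaternion X"
  shows "det2 X = 0 \<longleftrightarrow> X = 0"
proof
  assume "det2 X = 0"
  then have "(\<Sum>p<4. (co p X)\<^sup>2) = 0" using det2_quaternion[OF assms] by (metis of_real_eq_0_iff)
  then have "\<And>p. p < 4 \<Longrightarrow> co p X = 0" by (subst (asm) sum_nonneg_eq_0_iff) auto
  then show "X = 0" using assms by (intro quaternion_eqI) (simp_all add: quaternion_def co_def)
qed (simp add: det2_def)

lemma block_act:
  assumes "quaternion P" "block im Y"
  shows "block im (act im P Y)"
proof -
  have "tr2 (P * Y * adj P) = det2 P * tr2 Y"
    by (simp add: tr2_def det2_def algebra_simps)
  moreover have "quaternion Y" using assms(2) by (simp add: block_def)
  ultimately show ?thesis using assms unfolding block_def act_def
    by (cases im) (simp_all only: if_True if_False simp_thms,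
      auto intro: quaternion_sc[OF quaternion_mult] quaternion_mult quaternion_adj simp del: of_real_divide)
qed

lemma det2_act:
  assumes "det2 P = of_real \<Delta>" "\<Delta> > 0"
  shows "det2 (act im P Y) = det2 Y"
proof (cases im)
  case True
  then show ?thesis using assms by (simp add: act_def power2_eq_square)
next
  case False
  have "(complex_of_real (1 / sqrt \<Delta>))\<^sup>2 = 1 / of_real \<Delta>"
    using assms by (simp flip: of_real_power add: power_divide)
  then show ?thesis using False assms by (simp add: act_def)
qed

lemma act_add: "act im P (X + Y) = act im P X + act im P Y"
  by (simp add: act_def sc_add algebra_simps)

lemma act_sc: "act im P (sc k X) = sc k (act im P X)"
  by (simp add: act_def sc_mult mult.commute)

text \<open>The action of \<open>P Q\<^sup>-\<^sup>1\<close>, written without denominators.\<close>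

lemma act_transport_imaginary:
  assumes "det2 P = of_real \<Delta>" "det2 Q = of_real \<Delta>"
  shows "act True P Y * (P * adj Q) = P * adj Q * act True Q Y"
proof -
  have "act True P Y * (P * adj Q) = sc (of_real (1 / \<Delta>)) (P * Y * (adj P * P) * adj Q)"
    using assms by (simp add: act_def sc_mult mult.assoc)
  also have "\<dots> = sc (of_real (1 / \<Delta>)) (P * (adj Q * Q) * Y * adj Q)"
    using assms by (simp add: mult_adj sc_mult)
  also have "\<dots> = P * adj Q * act True Q Y"
    using assms by (simp add: act_def sc_mult mult.assoc)
  finally show ?thesis .
qed

lemma act_transport_full:
  assumes "det2 P = of_real \<Delta>" "det2 Q = of_real \<Delta>"
  shows "sc (of_real \<Delta>) (act False P Y) = P * adj Q * act False Q Y"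
proof -
  have "P * adj Q * act False Q Y = sc (of_real (1 / sqrt \<Delta>)) (P * (adj Q * Q) * Y)"
    using assms by (simp add: act_def sc_mult mult.assoc)
  also have "\<dots> = sc (of_real \<Delta>) (act False P Y)"
    using assms by (simp add: mult_adj sc_mult act_def)
  finally show ?thesis ..
qed

lemma block_axis_1: "block im (axis 1)"
  by (simp add: block_def quaternion_axis) (simp add: tr2_def axis_def)

lemma det2_pencil:
  assumes "cmod (w a) = 1" "det2 (q a) = 1"
  shows "det2 (pencil w q (of_real s) a) = of_real (1 + s\<^sup>2)"
proof -
  have "det2 (1 + sc (of_real s) (axis (w a))) = 1 + (of_real s)\<^sup>2 * (w a * cnj (w a))"
    by (simp add: det2_def axis_def power2_eq_square algebra_simps)
  then show ?thesis using assms by (simp add: pencil_def unit_cnj)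
qed

lemma quaternion_pencil: "quaternion (q a) \<Longrightarrow> quaternion (pencil w q (of_real s) a)"
  unfolding pencil_def
  by (intro quaternion_mult quaternion_add quaternion_1 quaternion_sc quaternion_axis)

definition unit :: "nat \<Rightarrow> mat2" where
  "unit p = quat (of_bool (p = 0)) (of_bool (p = 1)) (of_bool (p = 2)) (of_bool (p = 3))"

lemma co_unit: "p < 4 \<Longrightarrow> p' < 4 \<Longrightarrow> co p (unit p') = of_bool (p = p')"
  by (auto simp: co_def unit_def quat_def)

text \<open>Left multiplication moves \<open>axis 1\<close> to any quaternion of the same norm. For conjugation the half turn about the
  bisector of \<open>axis 1\<close> and the target serves, except when they are parallel.\<close>

lemma exists_rotation_to_unit:
  assumes "p < 4" "im \<longrightarrow> p \<noteq> 0" "\<sigma> = 1 \<or> \<sigma> = (- 1 :: real)"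
  shows "\<exists>q. quaternion q \<and> det2 q = 1 \<and> act im q (axis 1) = sc (of_real \<sigma>) (unit p)"
proof (cases im)
  case False
  let ?q = "sc (of_real \<sigma>) (unit p * adj (axis 1))"
  have "quaternion ?q"
    by (intro quaternion_sc quaternion_mult quaternion_adj quaternion_axis) (simp add: unit_def quaternion_quat)
  moreover have d: "det2 ?q = 1"
    using assms(1,3) by (auto simp: less_Suc_eq eval_nat_numeral det2_def unit_def axis_def quat_def complex_eq_iff)
  moreover have "act im ?q (axis 1) = sc (of_real \<sigma>) (unit p)"
  proof -
    have "unit p * adj (axis 1) * axis 1 = unit p"
      by (simp add: mult_adj_assoc) (simp add: det2_def axis_def)
    then show ?thesis using False d unfolding act_def by (simp add: sc_mult)
  qed
  ultimately show ?thesis by blast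
next
  case True
  define r where "r = (1 / sqrt 2 :: real)"
  have r: "r * r = 1 / 2" "r * (r * t) = t / 2" for t by (simp_all add: r_def)
  define q where "q = (if p = 2 then (if \<sigma> = 1 then quat 1 0 0 0 else quat 0 1 0 0)
    else if p = 1 then quat 0 (\<sigma> * r) r 0 else quat 0 0 r (\<sigma> * r))"
  have p: "p = 1 \<or> p = 2 \<or> p = 3" using assms(1,2) True by auto
  have "quaternion q" by (simp add: q_def quaternion_quat)
  moreover have d: "det2 q = 1"
    using p assms(3) by (auto simp: q_def quat_def det2_def complex_eq_iff r)
  moreover have "act im q (axis 1) = sc (of_real \<sigma>) (unit p)"
    using True p assms(3) unfolding act_def d
    by (auto simp: q_def quat_def unit_def axis_def mat2_eq_iff complex_eq_iff r)
  ultimately show ?thesis by blast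
qed

section \<open>Splitting the space into blocks\<close>

locale block_chart =
  fixes pos :: "'n::finite \<Rightarrow> nat \<times> nat" and im :: "nat \<Rightarrow> bool" and K :: nat
  assumes pos: "bij_betw pos UNIV {(b, p). b < K \<and> p < 4 \<and> (im b \<longrightarrow> p \<noteq> 0)}"
    and K: "0 < K" and im0: "im 0"
begin

text \<open>The value is 0 for the real part of an imaginary block, where no coordinate of the space sits.\<close>

definition crd :: "real ^ 'n \<Rightarrow> nat \<Rightarrow> nat \<Rightarrow> real" where
  "crd x b p = (if (b, p) \<in> range pos then x $ (inv pos (b, p)) else 0)"

definition emb :: "real ^ 'n \<Rightarrow> nat \<Rightarrow> mat2" where
  "emb x b = quat (crd x b 0) (crd x b 1) (crd x b 2) (crd x b 3)"

definition unemb :: "(nat \<Rightarrow> mat2) \<Rightarrow> real ^ 'n" where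
  "unemb Z = (\<chi> j. co (snd (pos j)) (Z (fst (pos j))))"

lemma inj_pos: "inj pos"
  using pos by (simp add: bij_betw_def)

lemma range_pos: "range pos = {(b, p). b < K \<and> p < 4 \<and> (im b \<longrightarrow> p \<noteq> 0)}"
  using pos by (simp add: bij_betw_def)

lemma pos_bounds: "fst (pos j) < K" "snd (pos j) < 4" "im (fst (pos j)) \<Longrightarrow> snd (pos j) \<noteq> 0"
  using range_pos rangeI[of pos j] by auto

lemma crd_pos: "crd x (fst (pos j)) (snd (pos j)) = x $ j"
  using inj_pos by (simp add: crd_def)

lemma co_emb: "p < 4 \<Longrightarrow> co p (emb x b) = crd x b p"
  by (auto simp: emb_def co_def quat_def less_Suc_eq eval_nat_numeral)

lemma nth_emb: "x $ j = co (snd (pos j)) (emb x (fst (pos j)))"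
  by (simp add: co_emb pos_bounds crd_pos)

lemma block_emb: "block (im b) (emb x b)"
proof -
  have "crd x b 0 = 0" if "im b" using that range_pos by (auto simp: crd_def)
  then show ?thesis
    by (auto simp: block_def quaternion_quat emb_def) (simp add: quat_def tr2_def complex_eq_iff)
qed

lemma quaternion_emb: "quaternion (emb x b)"
  using block_emb by (simp add: block_def)

lemma emb_add: "emb (x + y) b = emb x b + emb y b"
  by (simp add: emb_def quat_def crd_def mat2_eq_iff complex_eq_iff)

lemma emb_diff: "emb (x - y) b = emb x b - emb y b"
  by (simp add: emb_def quat_def crd_def mat2_eq_iff complex_eq_iff)

lemma emb_scaleR: "emb (r *\<^sub>R x) b = sc (of_real r) (emb x b)"
  by (simp add: emb_def quat_def crd_def mat2_eq_iff complex_eq_iff)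

lemma emb_0: "emb 0 b = 0"
  by (simp add: emb_def quat_def crd_def mat2_eq_iff complex_eq_iff)

lemma emb_unemb:
  assumes "b < K" "block (im b) (Z b)"
  shows "emb (unemb Z) b = Z b"
proof (rule quaternion_eqI)
  fix p :: nat assume p: "p < 4"
  show "co p (emb (unemb Z) b) = co p (Z b)"
  proof (cases "(b, p) \<in> range pos")
    case True
    then show ?thesis using p by (auto simp: co_emb crd_def unemb_def f_inv_into_f)
  next
    case False
    then have "im b" "p = 0" using assms(1) p range_pos by auto
    have "co p (emb (unemb Z) b) = 0" using False p by (simp add: co_emb crd_def)
    moreover have "co p (Z b) = 0" using assms(2) \<open>im b\<close> \<open>p = 0\<close>
      by (simp add: co_def block_def tr2_def quaternion_def complex_eq_iff)
    ultimately show ?thesis by simp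
  qed
qed (use assms quaternion_emb in \<open>auto simp: block_def\<close>)

lemma inner_emb: "x \<bullet> y = (\<Sum>b<K. \<Sum>p<4. co p (emb x b) * co p (emb y b))"
proof -
  have "x \<bullet> y = (\<Sum>j\<in>UNIV. crd x (fst (pos j)) (snd (pos j)) * crd y (fst (pos j)) (snd (pos j)))"
    by (simp add: inner_vec_def crd_pos)
  also have "\<dots> = (\<Sum>(b, p)\<in>range pos. crd x b p * crd y b p)"
    by (simp add: sum.reindex[OF inj_pos] case_prod_beta)
  also have "\<dots> = (\<Sum>(b, p)\<in>{..<K} \<times> {..<4}. crd x b p * crd y b p)"
    by (rule sum.mono_neutral_left) (use range_pos in \<open>auto simp: crd_def\<close>)
  also have "\<dots> = (\<Sum>b<K. \<Sum>p<4. crd x b p * crd y b p)"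
    by (rule sum.cartesian_product[symmetric])
  finally show ?thesis by (simp add: co_emb)
qed

lemma norm_emb: "complex_of_real ((norm x)\<^sup>2) = (\<Sum>b<K. det2 (emb x b))"
proof -
  have "(norm x)\<^sup>2 = (\<Sum>b<K. \<Sum>p<4. (co p (emb x b))\<^sup>2)"
    unfolding power2_norm_eq_inner inner_emb by (simp add: power2_eq_square)
  then show ?thesis by (simp only: det2_quaternion[OF quaternion_emb] of_real_sum)
qed

definition rot :: "(nat \<Rightarrow> mat2) \<Rightarrow> real ^ 'n \<Rightarrow> real ^ 'n" where
  "rot P x = unemb (\<lambda>b. act (im b) (P b) (emb x b))"

lemma emb_rot:
  assumes "\<And>b. quaternion (P b)" "b < K"
  shows "emb (rot P x) b = act (im b) (P b) (emb x b)"
  unfolding rot_def using assms by (intro emb_unemb block_act block_emb) auto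

lemma nth_rot: "rot P x $ j = co (snd (pos j)) (act (im (fst (pos j))) (P (fst (pos j))) (emb x (fst (pos j))))"
  by (simp add: rot_def unemb_def)

lemma co_add: "co p (X + Y) = co p X + co p Y"
  by (simp add: co_def)

lemma co_sc: "co p (sc (of_real r) X) = r * co p X"
  by (simp add: co_def)

lemma orthogonal_transformation_rot:
  assumes "\<And>b. quaternion (P b)" "\<And>b. det2 (P b) = of_real \<Delta>" "\<Delta> > 0"
  shows "orthogonal_transformation (rot P)"
  unfolding orthogonal_transformation
proof (intro conjI allI)
  show "linear (rot P)"
    by (rule linearI)
      (simp_all add: vec_eq_iff nth_rot emb_add emb_scaleR act_add act_sc co_add co_sc)
next
  fix x
  have "complex_of_real ((norm (rot P x))\<^sup>2) = complex_of_real ((norm x)\<^sup>2)"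
    unfolding norm_emb using assms
    by (intro sum.cong refl) (simp add: emb_rot det2_act[OF assms(2,3)])
  then have "(norm (rot P x))\<^sup>2 = (norm x)\<^sup>2" by (simp only: of_real_eq_iff)
  then show "norm (rot P x) = norm x" by simp
qed

lemma isometry_rot_shift:
  assumes "orthogonal_transformation (rot P)"
  shows "isometry (\<lambda>x. rot P (x - a))"
proof -
  have "bij (rot P \<circ> (\<lambda>x. x - a))"
    by (rule bij_comp[OF _ orthogonal_transformation_bij[OF assms]])
      (rule bij_betwI[of _ _ _ "\<lambda>x. x + a"], auto)
  moreover have "dist (rot P (x - a)) (rot P (y - a)) = dist x y" for x y
    using assms by (simp add: orthogonal_transformation_isometry) (simp add: dist_norm)
  ultimately show ?thesis by (simp add: isometry_def comp_def)
qed

text \<open>A vector of norm 1 in each block. It is the common direction of the caps before rotation, and in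
  block 0 it is parallel to the axis of the one isometry that moves the centre, which so becomes a screw
  motion.\<close>

definition base :: "real ^ 'n" where
  "base = unemb (\<lambda>_. axis 1)"

lemma emb_base: "b < K \<Longrightarrow> emb base b = axis 1"
  unfolding base_def by (rule emb_unemb) (simp_all add: block_axis_1)

end

section \<open>Choosing the parameter\<close>

text \<open>In this order: cycles through \<open>z\<close> have no fixed point in block 0, words containing \<open>z\<close> move
  the centre, and words commute only if their first and last letters allow it.\<close>

definition good_parameter ::
  "(nat \<Rightarrow> 'l \<Rightarrow> complex) \<Rightarrow> (nat \<Rightarrow> 'l \<Rightarrow> mat2) \<Rightarrow> 'l \<Rightarrow> complex \<Rightarrow> complex \<Rightarrow> bool" where
  "good_parameter w q z h s \<longleftrightarrow>
    (\<forall>ws. cyclic ws \<longrightarrow> z \<in> letters ws \<longrightarrow>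
      tr2 (wshift (\<lambda>a. if a = z then sc h (axis 1) else 0) (pencil (w 0) (q 0) s) ws) \<noteq> 0) \<and>
    (\<forall>ws. reduced ws \<longrightarrow> z \<in> letters ws \<longrightarrow>
      wshift (\<lambda>a. if a = z then sc h (axis 1) else 0) (pencil (w 0) (q 0) s) ws \<noteq> 0) \<and>
    (\<forall>b us vs. us \<noteq> [] \<longrightarrow> reduced us \<longrightarrow> vs \<noteq> [] \<longrightarrow> reduced vs \<longrightarrow>
      fst (hd us) \<noteq> fst (hd vs) \<longrightarrow> snd (last us) \<noteq> fst (hd vs) \<longrightarrow>
      wprod (pencil (w b) (q b) s) us * wprod (pencil (w b) (q b) s) vs \<noteq>
      wprod (pencil (w b) (q b) s) vs * wprod (pencil (w b) (q b) s) us)"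

lemma exists_good_parameter:
  fixes z :: "'l::finite"
  assumes g: "\<And>b. generic (w b) (q b)" and w: "w 0 z = 1" and h: "h \<noteq> 0" and "\<delta> > 0"
  shows "\<exists>s::real. 0 < s \<and> s < \<delta> \<and> good_parameter w q z h (of_real s)"
proof -
  define c where "c a = (if a = z then sc h (axis 1) else 0)" for a
  define T where "T ws s = wshift c (pencil (w 0) (q 0) s) ws" for ws s
  define M where "M b us vs s = wprod (pencil (w b) (q b) s) us * wprod (pencil (w b) (q b) s) vs -
      wprod (pencil (w b) (q b) s) vs * wprod (pencil (w b) (q b) s) us" for b us vs s
  have T: "T ws (- \<i>) = sc (\<i> * h * of_nat (occurrences z ws)) (wprod (pencil (w 0) (q 0) (- \<i>)) ws)" for ws
    unfolding T_def c_def by (rule wshift_at_minus_ii[OF g w])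
  have pT: "poly_mat (T ws)" for ws unfolding T_def by (rule poly_mat_wshift)
  have pM: "poly_mat (M b us vs)" for b us vs
    unfolding M_def by (intro poly_mat_diff poly_mat_mult poly_mat_wprod)
  have f1: "finite {s. tr2 (T ws s) = 0}" if "cyclic ws" "z \<in> letters ws" for ws
    using tr2_wprod_at_minus_ii[OF g that(1), of 0] occurrences_pos[OF that(2)] h
    by (intro poly_fun_finite_zeros[OF poly_fun_tr2[OF pT], of _ "- \<i>"]) (simp add: T)
  have f2: "finite {s. T ws s = 0}" if "reduced ws" "z \<in> letters ws" for ws
  proof (rule poly_mat_finite_zeros[OF pT, of _ "- \<i>"])
    have "ws \<noteq> []" using that by (auto simp: letters_def)
    moreover have "\<i> * h * of_nat (occurrences z ws) \<noteq> 0" using h occurrences_pos[OF that(2)] by simp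
    ultimately show "T ws (- \<i>) \<noteq> 0"
      using wprod_at_minus_ii_nonzero[OF g _ that(1), of 0] unfolding T
      by (simp add: mat2_eq_iff)
  qed
  have f3: "finite {s. M b us vs s = 0}"
    if "us \<noteq> []" "reduced us" "vs \<noteq> []" "reduced vs" "fst (hd us) \<noteq> fst (hd vs)"
      "snd (last us) \<noteq> fst (hd vs)" for b us vs
    by (rule poly_mat_finite_zeros[OF pM, of _ _ _ "- \<i>"])
      (use commuting_at_minus_ii[OF g that(1-4) _ that(5), of b] that(6) in \<open>auto simp: M_def\<close>)
  \<comment> \<open>Finitely many bad values for each of countably many words.\<close>
  define Bad where "Bad = (\<Union>ws\<in>{ws. cyclic ws \<and> z \<in> letters ws}. {s. tr2 (T ws s) = 0}) \<union>
    (\<Union>ws\<in>{ws. reduced ws \<and> z \<in> letters ws}. {s. T ws s = 0}) \<union>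
    (\<Union>(b, us, vs)\<in>{(b, us, vs). us \<noteq> [] \<and> reduced us \<and> vs \<noteq> [] \<and> reduced vs \<and>
      fst (hd us) \<noteq> fst (hd vs) \<and> snd (last us) \<noteq> fst (hd vs)}. {s. M b us vs s = 0})"
  have "countable Bad"
    unfolding Bad_def
    by (intro countable_Un countable_UN countableI_type)
      (use f1 f2 f3 in \<open>auto intro: countable_finite\<close>)
  then have "countable (complex_of_real ` {s. complex_of_real s \<in> Bad})"
    by (rule countable_subset[rotated]) auto
  then have "countable {s. complex_of_real s \<in> Bad}"
    by (rule countable_image_inj_on) (simp add: inj_on_def)
  then have "\<not> {0<..<\<delta>} \<subseteq> {s. complex_of_real s \<in> Bad}"
    using uncountable_open_interval[of 0 \<delta>] assms(4) countable_subset by blast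
  then obtain s where "s \<in> {0<..<\<delta>}" and s3: "complex_of_real s \<notin> Bad" by blast
  then have s: "0 < s" "s < \<delta>" "complex_of_real s \<notin> Bad" by simp_all
  have "good_parameter w q z h (of_real s)"
    using s(3) unfolding Bad_def good_parameter_def T_def M_def c_def by simp blast
  then show ?thesis using s by blast
qed

section \<open>The group generated by rotations and one screw motion\<close>

locale screw_system = block_chart pos im K
  for pos :: "'n::finite \<Rightarrow> nat \<times> nat" and im K +
  fixes w :: "nat \<Rightarrow> 'l::finite \<Rightarrow> complex" and q :: "nat \<Rightarrow> 'l \<Rightarrow> mat2" and z :: 'l
    and \<epsilon> s :: real
  assumes unit_w: "cmod (w b a) = 1" and w_z: "w b z = 1" and q_z: "q b z = 1"
    and quaternion_q: "quaternion (q b a)" and det_q: "det2 (q b a) = 1"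
    and good: "good_parameter w q z (of_real (- \<epsilon>)) (of_real s)"
begin

definition P :: "'l \<Rightarrow> nat \<Rightarrow> mat2" where
  "P a b = pencil (w b) (q b) (of_real s) a"

definition \<Delta> :: real where
  "\<Delta> = 1 + s\<^sup>2"

definition f :: "'l \<Rightarrow> real ^ 'n \<Rightarrow> real ^ 'n" where
  "f a x = rot (P a) (x - (if a = z then \<epsilon> *\<^sub>R base else 0))"

lemma Delta_pos: "\<Delta> > 0"
  by (simp add: \<Delta>_def add_pos_nonneg)

lemma quaternion_P: "quaternion (P a b)"
  unfolding P_def by (rule quaternion_pencil) (rule quaternion_q)

lemma det_P: "det2 (P a b) = of_real \<Delta>"
  unfolding P_def \<Delta>_def by (rule det2_pencil[where q = "q b", OF unit_w det_q])

lemma orthogonal_rot: "orthogonal_transformation (rot (P a))"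
  by (rule orthogonal_transformation_rot[OF quaternion_P det_P Delta_pos])

lemma isometry_f: "isometry (f a)"
  unfolding f_def by (rule isometry_rot_shift[OF orthogonal_rot])

lemma bij_f: "bij (f a)"
  using isometry_f by (simp add: isometry_def)

lemma f_inv: "f a (inv (f a) x) = x"
  using bij_f by (simp add: bij_is_surj surj_f_inv_f)

lemma inv_f: "inv (f a) (f a x) = x"
  using bij_f by (simp add: bij_is_inj)

definition c :: "'l \<Rightarrow> mat2" where
  "c a = (if a = z then sc (of_real (- \<epsilon>)) (axis 1) else 0)"

lemma emb_f_0: "emb (f a x) 0 = act True (P a 0) (emb x 0) + c a"
proof -
  have "emb (f a x) 0 = act True (P a 0) (emb (x - (if a = z then \<epsilon> *\<^sub>R base else 0)) 0)"
    using emb_rot[OF quaternion_P K] im0 by (simp add: f_def)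
  moreover have "act True (P z 0) (axis 1) = axis 1"
  proof -
    have "P z 0 * axis 1 = axis 1 * P z 0"
      using w_z[of 0] q_z[of 0] by (simp add: P_def pencil_def algebra_simps sc_mult)
    then have "P z 0 * axis 1 * adj (P z 0) = sc (of_real \<Delta>) (axis 1)"
      by (simp add: mult.assoc mult_adj det_P sc_mult)
    then show ?thesis using Delta_pos by (simp add: act_def det_P)
  qed
  moreover have "act True Q (X - Y) = act True Q X - act True Q Y" for Q X Y
    by (simp add: act_def sc_add algebra_simps)
  moreover have "sc (of_real (- \<epsilon>)) X = - sc (of_real \<epsilon>) X" for X
    by (simp add: mat2_eq_iff)
  ultimately show ?thesis
    using K by (cases "a = z") (simp_all add: c_def emb_diff emb_scaleR emb_base act_sc)
qed

lemma emb_f_linear: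
  assumes "a \<noteq> z" "b < K"
  shows "emb (f a x) b = act (im b) (P a b) (emb x b)"
  using assms emb_rot[OF quaternion_P] by (simp add: f_def)

lemma step_affine:
  "emb (f a (inv (f b) v)) 0 * (P a 0 * adj (P b 0)) =
     P a 0 * adj (P b 0) * emb v 0 + (c a * (P a 0 * adj (P b 0)) - P a 0 * adj (P b 0) * c b)"
proof -
  define y A B G where "y = inv (f b) v" and "A = act True (P a 0) (emb y 0)"
    and "B = act True (P b 0) (emb y 0)" and "G = P a 0 * adj (P b 0)"
  have AB: "A * G = G * B"
    unfolding A_def B_def G_def by (rule act_transport_imaginary[OF det_P det_P])
  have a: "emb (f a y) 0 = A + c a" and "emb (f b y) 0 = B + c b"
    by (simp_all add: emb_f_0 A_def B_def)
  then have b: "emb v 0 = B + c b" by (simp add: y_def f_inv)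
  have "emb (f a y) 0 * G = G * emb v 0 + (c a * G - G * c b)"
    unfolding a b by (simp add: distrib_left distrib_right AB)
  then show ?thesis by (simp add: y_def G_def)
qed

text \<open>The law of composition behind \<open>wshift\<close>. If \<open>x\<close> is fixed, the shift is a commutator and so
  has trace 0.\<close>

lemma walk_affine:
  "emb (walk f ws x) 0 * wprod (\<lambda>a. P a 0) ws =
     wprod (\<lambda>a. P a 0) ws * emb x 0 + wshift c (\<lambda>a. P a 0) ws"
proof (induction ws)
  case (Cons p ws)
  obtain a b where p: "p = (a, b)" by force
  define v where "v = walk f ws x"
  define G where "G = P a 0 * adj (P b 0)"
  define W where "W = wprod (\<lambda>a. P a 0) ws"
  have "emb (f a (inv (f b) v)) 0 * (G * W) = (emb (f a (inv (f b) v)) 0 * G) * W"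
    by (simp only: mult.assoc)
  also have "\<dots> = (G * emb v 0 + (c a * G - G * c b)) * W"
    unfolding G_def step_affine ..
  also have "\<dots> = G * (emb v 0 * W) + (c a * G - G * c b) * W"
    by (simp only: distrib_right mult.assoc)
  also have "emb v 0 * W = W * emb x 0 + wshift c (\<lambda>a. P a 0) ws"
    using Cons.IH by (simp add: v_def W_def)
  finally show ?case by (simp add: p v_def G_def W_def distrib_left mult.assoc add_ac)
qed simp

text \<open>For the full quaternions the normalising factors cannot be cancelled by conjugation and
  remain as a power of \<open>\<Delta>\<close>.\<close>

lemma walk_linear:
  assumes "z \<notin> letters ws" "b < K"
  shows "if im b then emb (walk f ws x) b * wprod (\<lambda>a. P a b) ws = wprod (\<lambda>a. P a b) ws * emb x b
    else sc (of_real (\<Delta> ^ length ws)) (emb (walk f ws x) b) = wprod (\<lambda>a. P a b) ws * emb x b"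
  using assms(1)
proof (induction ws)
  case (Cons p ws)
  obtain a a' where p: "p = (a, a')" by force
  define v y where "v = walk f ws x" and "y = inv (f a') v"
  have z: "a \<noteq> z" "a' \<noteq> z" "z \<notin> letters ws" using Cons.prems by (auto simp: letters_def p)
  have v: "emb v b = act (im b) (P a' b) (emb y b)"
    using emb_f_linear[OF z(2) assms(2), of y] by (simp add: y_def f_inv)
  note v' = emb_f_linear[OF z(1) assms(2), of y]
  show ?case
  proof (cases "im b")
    case True
    have "emb (f a y) b * (P a b * adj (P a' b)) = P a b * adj (P a' b) * emb v b"
      using act_transport_imaginary[OF det_P det_P] by (simp add: v v' True)
    then have "emb (f a y) b * (P a b * adj (P a' b)) * wprod (\<lambda>a. P a b) ws
        = P a b * adj (P a' b) * wprod (\<lambda>a. P a b) ws * emb x b"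
      using Cons.IH[OF z(3)] True by (simp add: v_def mult.assoc)
    then show ?thesis using True by (simp add: p v_def y_def mult.assoc)
  next
    case False
    have "sc (of_real \<Delta>) (emb (f a y) b) = P a b * adj (P a' b) * emb v b"
      using act_transport_full[OF det_P det_P] by (simp add: v v' False)
    then have "sc (of_real (\<Delta> ^ length ws)) (sc (of_real \<Delta>) (emb (f a y) b)) =
        P a b * adj (P a' b) * sc (of_real (\<Delta> ^ length ws)) (emb v b)"
      by (simp only: sc_mult)
    also have "\<dots> = P a b * adj (P a' b) * (wprod (\<lambda>a. P a b) ws * emb x b)"
      using Cons.IH[OF z(3)] False by (simp add: v_def)
    finally show ?thesis using False by (simp add: p v_def y_def mult.assoc mult.commute)
  qed
qed simp

text \<open>Rotations of a three-dimensional block with a common fixed vector have a common axis. On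
  the full quaternions only scalars have a fixed vector.\<close>

lemma fixing_words_commute:
  assumes us: "z \<notin> letters us" "walk f us x = x" and vs: "z \<notin> letters vs" "walk f vs x = x"
    and b: "b < K" "emb x b \<noteq> 0"
  shows "wprod (\<lambda>a. P a b) us * wprod (\<lambda>a. P a b) vs = wprod (\<lambda>a. P a b) vs * wprod (\<lambda>a. P a b) us"
proof (cases "im b")
  case True
  show ?thesis
  proof (rule centralizer_commutative)
    show "emb x b * wprod (\<lambda>a. P a b) us = wprod (\<lambda>a. P a b) us * emb x b"
      using walk_linear[OF us(1) b(1), of x] us(2) True by simp
    show "emb x b * wprod (\<lambda>a. P a b) vs = wprod (\<lambda>a. P a b) vs * emb x b"
      using walk_linear[OF vs(1) b(1), of x] vs(2) True by simp
    show "tr2 (emb x b) = 0" using block_emb[of b x] True by (simp add: block_def)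
  qed (rule b(2))
next
  case False
  have d: "det2 (emb x b) \<noteq> 0" using b(2) det2_quaternion_eq_0[OF quaternion_emb] by simp
  have scalar: "wprod (\<lambda>a. P a b) us = sc (of_real (\<Delta> ^ length us)) 1"
    if "z \<notin> letters us" "walk f us x = x" for us
  proof -
    have "sc (of_real (\<Delta> ^ length us)) (emb x b) * adj (emb x b) =
        wprod (\<lambda>a. P a b) us * emb x b * adj (emb x b)"
      using walk_linear[OF that(1) b(1), of x] that(2) False by simp
    then have "sc (det2 (emb x b)) (sc (of_real (\<Delta> ^ length us)) 1) =
        sc (det2 (emb x b)) (wprod (\<lambda>a. P a b) us)"
      by (simp add: mult_adj_assoc mult_adj sc_mult mult.commute)
    then show ?thesis using d by (simp only: sc_cancel[OF d])
  qed
  show ?thesis by (simp add: scalar[OF us] scalar[OF vs] sc_mult mult.commute)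
qed

lemma P_pencil: "(\<lambda>a. P a b) = pencil (w b) (q b) (of_real s)"
  by (simp add: P_def fun_eq_iff)

lemma cycle_avoids_z:
  assumes "cycle_at f ws y"
  shows "z \<notin> letters ws"
proof
  assume z: "z \<in> letters ws"
  define x where "x = f (snd (last ws)) y"
  have "walk f ws x = x" "cyclic ws" using assms by (simp_all add: cycle_at_def x_def)
  then have "wshift c (\<lambda>a. P a 0) ws =
      emb x 0 * wprod (\<lambda>a. P a 0) ws - wprod (\<lambda>a. P a 0) ws * emb x 0"
    using walk_affine[of ws x] by simp
  then have "tr2 (wshift c (\<lambda>a. P a 0) ws) = 0" by (simp only: tr2_diff_commutator)
  then show False
    using good \<open>cyclic ws\<close> z unfolding good_parameter_def P_pencil c_def[abs_def] by blast
qed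

text \<open>A cycle at \<open>y\<close> would give a word starting with \<open>z\<close> that fixes the centre.\<close>

lemma return_not_cycle:
  assumes "f z y = 0"
  shows "\<not> cycle_at f ws y"
proof
  assume "cycle_at f ws y"
  from cycle_at_return[OF bij_f this, of z] obtain vs where
    vs: "vs \<noteq> []" "reduced vs" "fst (hd vs) = z" "walk f vs 0 = 0" by (auto simp: assms)
  then have "z \<in> letters vs" unfolding letters_def using hd_in_set by blast
  moreover have "wshift c (\<lambda>a. P a 0) vs = 0" using walk_affine[of vs 0] vs(4) by (simp add: emb_0)
  ultimately show False
    using good vs(2) unfolding good_parameter_def P_pencil c_def[abs_def] by blast
qed

text \<open>Each letter in question starts a word that fixes \<open>x\<close>. Of three such words, the first would have to end
  with the first letter of the second and with the first letter of the third.\<close>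

lemma few_cycles_at:
  assumes "x \<noteq> 0"
  shows "card {i. i \<noteq> z \<and> (\<exists>ws. cycle_at f ws (inv (f i) x))} \<le> 2"
proof (rule ccontr)
  assume "\<not> ?thesis"
  then have "3 \<le> card {i. i \<noteq> z \<and> (\<exists>ws. cycle_at f ws (inv (f i) x))}" by simp
  then obtain J where J: "J \<subseteq> {i. i \<noteq> z \<and> (\<exists>ws. cycle_at f ws (inv (f i) x))}" "card J = 3"
    by (meson obtain_subset_with_card_n)
  then obtain i j k where ijk: "J = {i, j, k}" "i \<noteq> j" "i \<noteq> k" "j \<noteq> k" by (auto simp: card_3_iff)
  have "\<exists>b<K. emb x b \<noteq> 0"
  proof (rule ccontr)
    assume "\<not> ?thesis"
    moreover have "co p 0 = 0" for p by (simp add: co_def)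
    ultimately have "x \<bullet> x = 0" by (simp add: inner_emb)
    then show False using assms by simp
  qed
  then obtain b where b: "b < K" "emb x b \<noteq> 0" by blast
  have "\<exists>vs. vs \<noteq> [] \<and> reduced vs \<and> fst (hd vs) = i \<and> z \<notin> letters vs \<and> walk f vs x = x"
    if iJ: "i \<in> J" for i
  proof -
    obtain ws where ws: "i \<noteq> z" "cycle_at f ws (inv (f i) x)" using iJ J by blast
    then have "z \<notin> insert i (letters ws)" using cycle_avoids_z by simp
    with cycle_at_return[OF bij_f ws(2), of i] show ?thesis unfolding f_inv by blast
  qed
  then obtain V where V: "\<And>i. i \<in> J \<Longrightarrow> V i \<noteq> [] \<and> reduced (V i) \<and> fst (hd (V i)) = i \<and>
      z \<notin> letters (V i) \<and> walk f (V i) x = x" by metis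
  have last: "snd (last (V i)) = j" if "i \<in> J" "j \<in> J" "i \<noteq> j" for i j
    using fixing_words_commute[of "V i" x "V j" b] V[OF that(1)] V[OF that(2)] b that(3) good
    unfolding good_parameter_def P_pencil by metis
  show False using last[of i j] last[of i k] ijk by auto
qed

text \<open>Of four usable letters at \<open>x\<close> at most two are spoiled by cycles; the centre keeps its
  neighbour \<open>\<epsilon> *\<^sub>R base\<close>.\<close>

theorem divisible_ball:
  assumes B: "B = ball 0 1 \<or> B = cball 0 1"
    and cover: "\<And>x. x \<in> B \<Longrightarrow> 4 \<le> card {i. i \<noteq> z \<and> x - \<epsilon> *\<^sub>R rot (P i) base \<in> B}"
    and small: "norm (\<epsilon> *\<^sub>R base) < 1"
  shows "divisible_into CARD('l) B"
proof (rule divisible_into_forest[OF isometry_f _ refl, where r = 0])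
  have norm_B: "x \<in> B \<longleftrightarrow> y \<in> B" if "norm x = norm y" for x y using B that by auto
  have norm_rot: "norm (rot (P i) x) = norm x" for i x
    by (rule orthogonal_transformation_norm[OF orthogonal_rot])
  have lin: "linear (rot (P i))" for i by (rule orthogonal_transformation_linear[OF orthogonal_rot])
  have "0 \<in> B" using B by auto
  then show "B \<noteq> {}" by blast
  fix x assume x: "x \<in> B" "x \<noteq> 0"
  define I J where "I = {i. i \<noteq> z \<and> x - \<epsilon> *\<^sub>R rot (P i) base \<in> B}"
    and "J = {i. i \<noteq> z \<and> (\<exists>ws. cycle_at f ws (inv (f i) x))}"
  have "2 \<le> card I - card J" using cover[OF x(1)] few_cycles_at[OF x(2)] unfolding I_def J_def by linarith
  also have "\<dots> \<le> card (I - J)" by (rule diff_card_le_card_Diff) simp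
  finally obtain I' where "I' \<subseteq> I - J" "card I' = 2" by (meson obtain_subset_with_card_n)
  then obtain i j where ij: "i \<noteq> j" "i \<in> I - J" "j \<in> I - J" by (auto simp: card_2_iff)
  have "inv (f i) x \<in> {y. (\<forall>i. f i y \<in> B) \<and> \<not> (\<exists>ws. cycle_at f ws y)}" if i: "i \<in> I - J" for i
  proof -
    define y where "y = inv (f i) x"
    have "i \<noteq> z" using i by (simp add: I_def)
    then have fy: "x = rot (P i) y" using f_inv[of i x] by (simp add: f_def y_def)
    have "f k y \<in> B" for k
    proof (cases "k = z")
      case True
      have "norm (f k y) = norm (y - \<epsilon> *\<^sub>R base)" by (simp add: f_def True norm_rot)
      also have "\<dots> = norm (rot (P i) (y - \<epsilon> *\<^sub>R base))" by (simp add: norm_rot)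
      also have "\<dots> = norm (x - \<epsilon> *\<^sub>R rot (P i) base)"
        by (simp add: fy linear_diff[OF lin] linear_scale[OF lin])
      finally show ?thesis using i norm_B[of "f k y" "x - \<epsilon> *\<^sub>R rot (P i) base"] by (simp add: I_def)
    next
      case False
      then have "norm (f k y) = norm x" by (simp add: f_def norm_rot fy)
      then show ?thesis using x(1) norm_B[of "f k y" x] by simp
    qed
    moreover have "\<not> (\<exists>ws. cycle_at f ws y)" using i by (auto simp: y_def I_def J_def)
    ultimately show ?thesis by (simp add: y_def)
  qed
  then show "\<exists>i j. i \<noteq> j \<and> inv (f i) x \<in> {y. (\<forall>i. f i y \<in> B) \<and> \<not> (\<exists>ws. cycle_at f ws y)} \<and>
      inv (f j) x \<in> {y. (\<forall>i. f i y \<in> B) \<and> \<not> (\<exists>ws. cycle_at f ws y)}" using ij by blast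
next
  have norm_rot: "norm (rot (P i) x) = norm x" for i x
    by (rule orthogonal_transformation_norm[OF orthogonal_rot])
  have fz: "f z (\<epsilon> *\<^sub>R base) = 0"
    using norm_rot[of z 0] by (simp add: f_def)
  have "f k (\<epsilon> *\<^sub>R base) \<in> B" for k
  proof -
    have "norm (f k (\<epsilon> *\<^sub>R base)) < 1"
      using small norm_rot[of k "\<epsilon> *\<^sub>R base"] fz by (cases "k = z") (simp_all add: f_def)
    then show ?thesis using B by auto
  qed
  moreover have "inv (f z) 0 = \<epsilon> *\<^sub>R base" using inv_f[of z "\<epsilon> *\<^sub>R base"] fz by simp
  ultimately show "\<exists>i. inv (f i) 0 \<in> {y. (\<forall>i. f i y \<in> B) \<and> \<not> (\<exists>ws. cycle_at f ws y)}"
    using return_not_cycle[OF fz] by (intro exI[of _ z]) auto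
qed

end

section \<open>Covering the ball by caps\<close>

text \<open>One uses \<open>d mod 3\<close> blocks of dimension four and fills up with blocks of dimension three, of
  which at least one is needed for the screw motion.\<close>

lemma exists_block_chart:
  assumes "9 \<le> CARD('n::finite)"
  shows "\<exists>(pos :: 'n \<Rightarrow> nat \<times> nat) im K. block_chart pos im K"
proof -
  define e where "e = CARD('n) mod 3"
  define m where "m = (CARD('n) - 4 * e) div 3"
  have e: "e < 3" by (simp add: e_def)
  have d: "3 * m + 4 * e = CARD('n)" and m: "m > 0"
  proof -
    obtain k where k: "CARD('n) = 3 * k + e" by (metis e_def mult_div_mod_eq)
    then have "e < k" using e assms by linarith
    then have "CARD('n) - 4 * e = 3 * (k - e)" using k by (simp add: diff_mult_distrib2)
    then have "m = k - e" by (simp add: m_def)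
    then show "3 * m + 4 * e = CARD('n)" "m > 0" using k \<open>e < k\<close> by simp_all
  qed
  let ?S = "{(b, p). b < m + e \<and> p < 4 \<and> (b < m \<longrightarrow> p \<noteq> (0::nat))}"
  have S: "?S = (SIGMA b:{..<m + e}. {p. p < 4 \<and> (b < m \<longrightarrow> p \<noteq> 0)})" by auto
  have "card {p. p < 4 \<and> (b < m \<longrightarrow> p \<noteq> (0::nat))} = (if b < m then 3 else 4)" for b
  proof -
    have "{p. p < 4 \<and> p \<noteq> (0::nat)} = {1, 2, 3}" "{p. p < (4::nat)} = {0, 1, 2, 3}" by auto
    then show ?thesis by simp
  qed
  then have "card ?S = (\<Sum>b<m + e. if b < m then 3 else 4)"
    unfolding S by (subst card_SigmaI) auto
  also have "\<dots> = (\<Sum>b<m. 3) + (\<Sum>b=m..<m + e. 4)"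
    by (subst sum.atLeastLessThan_concat[of 0 m "m + e", symmetric, unfolded atLeast0LessThan]) auto
  finally have "card ?S = CARD('n)" using d by simp
  moreover have "finite ?S" unfolding S by simp
  ultimately have "\<exists>pos :: 'n \<Rightarrow> nat \<times> nat. bij_betw pos UNIV ?S"
    by (intro finite_same_card_bij) simp_all
  then obtain pos :: "'n \<Rightarrow> nat \<times> nat" where "bij_betw pos UNIV ?S" by (elim exE)
  then have "block_chart pos (\<lambda>b. b < m) (m + e)" using m by unfold_locales auto
  then show ?thesis by blast
qed

lemma tendsto_co_act_pencil:
  assumes "cmod (w a) = 1" "det2 (q a) = 1"
  shows "((\<lambda>s. co p (act im (pencil w q (of_real s) a) Y)) \<longlongrightarrow> co p (act im (q a) Y)) (at 0)"
proof -
  have cont: "isCont (\<lambda>s. co p (F (of_real s))) 0" if "poly_mat F" for F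
  proof -
    have c: "isCont (\<lambda>s. g (complex_of_real s)) 0" if "poly_fun g" for g
    proof -
      obtain r where "\<And>s. g s = poly r s" using \<open>poly_fun g\<close> by (auto simp: poly_fun_def)
      then show ?thesis by (auto intro!: continuous_intros)
    qed
    have "isCont (\<lambda>s. m11 (F (of_real s))) 0" "isCont (\<lambda>s. m12 (F (of_real s))) 0"
      using that c[of "\<lambda>s. m11 (F s)"] c[of "\<lambda>s. m12 (F s)"] by (simp_all add: poly_mat_def)
    then show ?thesis
      unfolding co_def
      by (cases "p = 0"; cases "p = 1"; cases "p = 2") (auto intro!: continuous_intros)
  qed
  have det: "Re (det2 (pencil w q (of_real s) a)) = 1 + s\<^sup>2" for s
    using det2_pencil[of w a q s] assms by simp
  define g where "g s = co p (act im (pencil w q (of_real s) a) Y)" for s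
  have "isCont g 0"
  proof (cases im)
    case True
    have g: "g = (\<lambda>s. 1 / (1 + s\<^sup>2) * co p (pencil w q (of_real s) a * Y * adj (pencil w q (of_real s) a)))"
      by (rule ext, simp only: g_def act_def True if_True det) (simp add: co_def)
    have "isCont (\<lambda>s. co p (pencil w q (of_real s) a * Y * adj (pencil w q (of_real s) a))) 0"
      by (rule cont[of "\<lambda>s. pencil w q s a * Y * adj (pencil w q s a)"])
        (intro poly_mat_intros poly_mat_pencil)
    then show ?thesis unfolding g by (intro continuous_intros) simp_all
  next
    case False
    have g: "g = (\<lambda>s. 1 / sqrt (1 + s\<^sup>2) * co p (pencil w q (of_real s) a * Y))"
      by (rule ext, simp only: g_def act_def False if_False det) (simp add: co_def)
    have "isCont (\<lambda>s. co p (pencil w q (of_real s) a * Y)) 0"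
      by (rule cont[of "\<lambda>s. pencil w q s a * Y"]) (intro poly_mat_intros poly_mat_pencil)
    then show ?thesis unfolding g by (intro continuous_intros) simp_all
  qed
  moreover have "g 0 = co p (act im (q a) Y)" by (simp add: g_def pencil_def)
  ultimately show ?thesis unfolding isCont_def by (simp add: g_def[abs_def])
qed

definition bool_sign :: "bool \<Rightarrow> real" where
  "bool_sign \<sigma> = (if \<sigma> then 1 else - 1)"

text \<open>The letter \<open>None\<close> is the screw motion. The others carry a coordinate, two signs and two further bits that
  make four copies of each rotation.\<close>

type_synonym 'n letter = "('n \<times> bool \<times> bool \<times> bool \<times> bool) option"

context block_chart
begin

definition rotor :: "nat \<Rightarrow> real \<Rightarrow> nat \<Rightarrow> mat2" where
  "rotor b \<sigma> p = (SOME q. quaternion q \<and> det2 q = 1 \<and>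
     act (im b) q (axis 1) = sc (of_real \<sigma>) (unit p))"

text \<open>The rotation at \<open>s = 0\<close>. It moves \<open>base\<close> to the vector that agrees with \<open>\<plusminus> base\<close> in all blocks but
  the one of coordinate \<open>j\<close>, and there is plus or minus the unit vector of that coordinate.\<close>

definition target :: "nat \<Rightarrow> 'n letter \<Rightarrow> mat2" where
  "target b a = (case a of None \<Rightarrow> 1
    | Some (j, \<sigma>, \<kappa>, _) \<Rightarrow> if b = fst (pos j) then rotor b (bool_sign \<kappa> * bool_sign \<sigma>) (snd (pos j))
        else rotor b (bool_sign \<kappa>) 2)"

lemma rotor:
  assumes "p < 4" "im b \<longrightarrow> p \<noteq> 0" "\<sigma> = 1 \<or> \<sigma> = - 1"
  shows "quaternion (rotor b \<sigma> p)" "det2 (rotor b \<sigma> p) = 1"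
    "act (im b) (rotor b \<sigma> p) (axis 1) = sc (of_real \<sigma>) (unit p)"
  using someI_ex[OF exists_rotation_to_unit[OF assms]] by (simp_all add: rotor_def)

lemma target: "quaternion (target b a)" "det2 (target b a) = 1"
proof -
  have "quaternion (target b a) \<and> det2 (target b a) = 1"
  proof (cases a)
    case None
    then show ?thesis by (simp add: target_def quaternion_1) (simp add: det2_def)
  next
    case (Some t)
    obtain j \<sigma> \<kappa> u where t: "t = (j, \<sigma>, \<kappa>, u)" by (cases t)
    have "bool_sign \<kappa> * bool_sign \<sigma> = 1 \<or> bool_sign \<kappa> * bool_sign \<sigma> = - 1" "bool_sign \<kappa> = 1 \<or> bool_sign \<kappa> = - 1"
      by (auto simp: bool_sign_def)
    then show ?thesis using pos_bounds[of j] by (auto simp: target_def Some t rotor)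
  qed
  then show "quaternion (target b a)" "det2 (target b a) = 1" by auto
qed

lemma inner_rot_target:
  "x \<bullet> rot (\<lambda>b. target b (Some (j, \<sigma>, \<kappa>, t))) base =
    bool_sign \<kappa> * ((\<Sum>b\<in>{..<K} - {fst (pos j)}. co 2 (emb x b)) + bool_sign \<sigma> * x $ j)"
proof -
  define v where "v = rot (\<lambda>b. target b (Some (j, \<sigma>, \<kappa>, t))) base"
  have pm: "bool_sign \<kappa> * bool_sign \<sigma> = 1 \<or> bool_sign \<kappa> * bool_sign \<sigma> = - 1" "bool_sign \<kappa> = 1 \<or> bool_sign \<kappa> = - 1"
    by (auto simp: bool_sign_def)
  have v: "emb v b = act (im b) (target b (Some (j, \<sigma>, \<kappa>, t))) (axis 1)" if "b < K" for b
    unfolding v_def using that by (subst emb_rot) (simp_all add: target emb_base)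
  have v0: "emb v (fst (pos j)) = sc (of_real (bool_sign \<kappa> * bool_sign \<sigma>)) (unit (snd (pos j)))"
    using v[OF pos_bounds(1)] rotor(3)[of "snd (pos j)" "fst (pos j)", OF pos_bounds(2) _ pm(1)] pos_bounds(3)
    by (simp add: target_def)
  have v1: "emb v b = sc (of_real (bool_sign \<kappa>)) (unit 2)" if "b < K" "b \<noteq> fst (pos j)" for b
    using v[OF that(1)] rotor(3)[of 2 b, OF _ _ pm(2)] that by (simp add: target_def)
  have pick: "(\<Sum>p<4. co p X * co p (sc (of_real r) (unit p'))) = r * co p' X" if "p' < 4" for X r p'
  proof -
    have "(\<Sum>p<4. co p X * co p (sc (of_real r) (unit p'))) = (\<Sum>p<4. if p = p' then r * co p' X else 0)"
      using that by (intro sum.cong refl) (simp add: co_sc co_unit)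
    then show ?thesis using that by simp
  qed
  have "x \<bullet> v = (\<Sum>p<4. co p (emb x (fst (pos j))) * co p (emb v (fst (pos j)))) +
      (\<Sum>b\<in>{..<K} - {fst (pos j)}. \<Sum>p<4. co p (emb x b) * co p (emb v b))"
    unfolding inner_emb using pos_bounds(1)[of j] by (intro sum.remove) auto
  also have "(\<Sum>p<4. co p (emb x (fst (pos j))) * co p (emb v (fst (pos j)))) = bool_sign \<kappa> * bool_sign \<sigma> * x $ j"
    unfolding v0 pick[OF pos_bounds(2)] by (simp flip: nth_emb)
  also have "(\<Sum>b\<in>{..<K} - {fst (pos j)}. \<Sum>p<4. co p (emb x b) * co p (emb v b)) =
      (\<Sum>b\<in>{..<K} - {fst (pos j)}. bool_sign \<kappa> * co 2 (emb x b))"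
    by (intro sum.cong refl) (use v1 pick[of 2] in auto)
  finally show ?thesis by (simp add: v_def sum_distrib_left algebra_simps)
qed

lemma exists_large_coordinate:
  fixes x :: "real ^ 'n"
  shows "\<exists>j. norm x / sqrt CARD('n) \<le> \<bar>x $ j\<bar>"
proof (rule ccontr)
  assume "\<not> ?thesis"
  then have less: "\<bar>x $ j\<bar> < norm x / sqrt CARD('n)" for j by (simp add: not_le)
  have "(norm x)\<^sup>2 = (\<Sum>j\<in>UNIV. (x $ j)\<^sup>2)"
    unfolding power2_norm_eq_inner inner_vec_def by (simp add: power2_eq_square)
  also have "\<dots> < (\<Sum>j\<in>(UNIV::'n set). (norm x / sqrt CARD('n))\<^sup>2)"
  proof (rule sum_strict_mono)
    fix j
    have "\<bar>x $ j\<bar>\<^sup>2 < (norm x / sqrt CARD('n))\<^sup>2"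
      by (rule power_strict_mono[OF less]) simp_all
    then show "(x $ j)\<^sup>2 < (norm x / sqrt CARD('n))\<^sup>2" by simp
  qed simp_all
  also have "\<dots> = (norm x)\<^sup>2" by (simp add: power_divide)
  finally show False by simp
qed

text \<open>With the sign \<open>\<sigma>\<close> the two summands of the inner product add up in absolute value, and \<open>\<kappa>\<close> makes the
  total positive. So the largest coordinate of \<open>x\<close> is a lower bound.\<close>

lemma exists_target_near:
  "\<exists>j \<sigma> \<kappa>. \<forall>t. norm x / sqrt CARD('n) \<le> x \<bullet> rot (\<lambda>b. target b (Some (j, \<sigma>, \<kappa>, t))) base"
proof -
  obtain j where j: "norm x / sqrt CARD('n) \<le> \<bar>x $ j\<bar>" using exists_large_coordinate by blast
  define T where "T = (\<Sum>b\<in>{..<K} - {fst (pos j)}. co 2 (emb x b))"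
  obtain \<sigma> where \<sigma>: "\<bar>x $ j\<bar> \<le> \<bar>T + bool_sign \<sigma> * x $ j\<bar>"
  proof (cases "0 \<le> T * x $ j")
    case True
    then have "\<bar>x $ j\<bar> \<le> \<bar>T + bool_sign True * x $ j\<bar>"
      by (auto simp: bool_sign_def zero_le_mult_iff)
    then show ?thesis by (rule that)
  next
    case False
    then have "\<bar>x $ j\<bar> \<le> \<bar>T + bool_sign False * x $ j\<bar>"
      by (auto simp: bool_sign_def zero_le_mult_iff not_le)
    then show ?thesis by (rule that)
  qed
  obtain \<kappa> where "bool_sign \<kappa> * (T + bool_sign \<sigma> * x $ j) = \<bar>T + bool_sign \<sigma> * x $ j\<bar>"
  proof (cases "0 \<le> T + bool_sign \<sigma> * x $ j")
    case True
    then show ?thesis by (intro that[of True]) (simp add: bool_sign_def)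
  next
    case False
    then show ?thesis by (intro that[of False]) (simp add: bool_sign_def[of False])
  qed
  then have "norm x / sqrt CARD('n) \<le> bool_sign \<kappa> * (T + bool_sign \<sigma> * x $ j)" using j \<sigma> by linarith
  then show ?thesis unfolding T_def inner_rot_target by blast
qed

lemma norm_base: "(norm base)\<^sup>2 = real K"
proof -
  have "complex_of_real ((norm base)\<^sup>2) = (\<Sum>b<K. det2 (axis 1))"
    unfolding norm_emb by (intro sum.cong refl) (simp add: emb_base)
  also have "\<dots> = of_nat K" by (simp add: det2_def axis_def)
  finally show ?thesis by (metis of_real_eq_iff of_real_of_nat_eq)
qed

text \<open>For points in the inner half of the ball all caps are large enough. For the others the gain
  \<open>2 \<epsilon> (x \<bullet> v)\<close> has to exceed the loss \<open>\<epsilon>\<^sup>2 K\<close>, where \<open>K\<close> is the squared norm of \<open>base\<close>; this dictates \<open>\<epsilon>\<close>. The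
  parameter \<open>s\<close> may depend on \<open>\<epsilon>\<close>, since it only has to be small enough for the rotations to stay near
  their targets.\<close>

theorem divisible_into_16_dim_plus_1:
  fixes B :: "(real ^ 'n) set"
  assumes B: "B = ball 0 1 \<or> B = cball 0 1"
  shows "divisible_into (16 * CARD('n) + 1) B"
proof -
  define d where "d = sqrt (real CARD('n))"
  have d: "d > 0" by (simp add: d_def)
  define \<epsilon> where "\<epsilon> = 1 / (4 * (real K + 1) * d)"
  have \<epsilon>: "\<epsilon> > 0" using d by (simp add: \<epsilon>_def add_nonneg_pos)
  have \<epsilon>K: "\<epsilon> * real K < 1 / (4 * d)"
  proof -
    have "\<epsilon> * (real K + 1) = 1 / (4 * d)" using d
      by (simp add: \<epsilon>_def divide_eq_eq eq_divide_eq add_nonneg_eq_0_iff)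
    then show ?thesis using \<epsilon> by (simp add: distrib_left)
  qed
  have d1: "1 \<le> d" unfolding d_def by (simp add: Suc_leI)
  have "norm base \<le> real K"
  proof -
    have "real K \<ge> 1" using K by simp
    then have "(norm base)\<^sup>2 \<le> (real K)\<^sup>2" unfolding norm_base by (simp add: power2_eq_square)
    then show ?thesis by (rule power2_le_imp_le) simp
  qed
  then have "\<epsilon> * norm base \<le> \<epsilon> * real K" using \<epsilon> by simp
  also have "\<dots> < 1 / 2" by (rule less_trans[OF \<epsilon>K]) (use d1 in \<open>simp add: field_simps\<close>)
  finally have small: "\<epsilon> * norm base < 1 / 2" .
  have "\<exists>w. generic w (target b) \<and> w None = 1" for b
    by (rule exists_generic[OF target(2)])
  then obtain w where w: "\<And>b. generic (w b) (target b)" "\<And>b. w b None = 1" by metis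
  have "\<forall>\<^sub>F s in at (0::real). \<forall>a\<in>UNIV. dist (rot (\<lambda>b. pencil (w b) (target b) (of_real s) a) base)
      (rot (\<lambda>b. target b a) base) < 1 / (2 * d)"
  proof (rule eventually_ball_finite)
    show "\<forall>a\<in>UNIV. \<forall>\<^sub>F s in at (0::real). dist (rot (\<lambda>b. pencil (w b) (target b) (of_real s) a) base)
      (rot (\<lambda>b. target b a) base) < 1 / (2 * d)"
    proof
      fix a
      have "((\<lambda>s. rot (\<lambda>b. pencil (w b) (target b) (of_real s) a) base) \<longlongrightarrow>
          rot (\<lambda>b. target b a) base) (at (0::real))"
        by (rule vec_tendstoI, unfold nth_rot, rule tendsto_co_act_pencil)
          (use w target in \<open>auto simp: generic_def\<close>)
      then show "\<forall>\<^sub>F s in at (0::real). dist (rot (\<lambda>b. pencil (w b) (target b) (of_real s) a) base)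
          (rot (\<lambda>b. target b a) base) < 1 / (2 * d)"
        by (rule tendstoD) (use d in simp)
    qed
  qed simp
  then obtain \<delta> :: real where \<delta>: "\<delta> > 0" "\<And>s a. s \<noteq> 0 \<Longrightarrow> \<bar>s\<bar> < \<delta> \<Longrightarrow>
      dist (rot (\<lambda>b. pencil (w b) (target b) (of_real s) a) base) (rot (\<lambda>b. target b a) base) < 1 / (2 * d)"
    unfolding eventually_at by (auto simp: dist_real_def)
  have "complex_of_real (- \<epsilon>) \<noteq> 0" using \<epsilon> by simp
  then obtain s :: real where s: "0 < s" "s < \<delta>"
    "good_parameter w target None (of_real (- \<epsilon>)) (of_real s)"
    using exists_good_parameter[of w target None "of_real (- \<epsilon>)" \<delta>] w \<delta>(1) by blast
  interpret screw_system pos im K w target None \<epsilon> s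
    by unfold_locales (use w target s in \<open>auto simp: generic_def target_def\<close>)
  have near: "dist (rot (P a) base) (rot (\<lambda>b. target b a) base) < 1 / (2 * d)" for a
    using \<delta>(2)[of s a] s by (simp add: P_def[abs_def])
  have "divisible_into CARD('n letter) B"
  proof (rule divisible_ball[OF B])
    show "norm (\<epsilon> *\<^sub>R base) < 1" using small \<epsilon> by simp
  next
    fix x assume x: "x \<in> B"
    obtain j \<sigma> \<kappa> where j: "\<And>t. norm x / d \<le> x \<bullet> rot (\<lambda>b. target b (Some (j, \<sigma>, \<kappa>, t))) base"
      using exists_target_near[of x] unfolding d_def by blast
    have "x - \<epsilon> *\<^sub>R rot (P a) base \<in> B" if a: "a = Some (j, \<sigma>, \<kappa>, t)" for a t
    proof -
      define v where "v = rot (P a) base"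
      have nv: "norm v = norm base"
        unfolding v_def by (rule orthogonal_transformation_norm[OF orthogonal_rot])
      have "norm (x - \<epsilon> *\<^sub>R v) < 1 \<or> norm (x - \<epsilon> *\<^sub>R v) \<le> norm x"
      proof (cases "norm x \<le> 1 / 2")
        case True
        have "norm (x - \<epsilon> *\<^sub>R v) \<le> norm x + norm (\<epsilon> *\<^sub>R v)" by (rule norm_triangle_ineq4)
        then show ?thesis using True small \<epsilon> by (simp add: nv)
      next
        case False
        define u where "u = rot (\<lambda>b. target b a) base"
        have "x \<bullet> u - x \<bullet> v \<le> norm x * norm (u - v)"
          using norm_cauchy_schwarz[of x "u - v"] by (simp add: inner_diff_right)
        also have "\<dots> \<le> norm x * (1 / (2 * d))"
          using near[of a] by (intro mult_left_mono) (simp_all add: u_def v_def dist_norm norm_minus_commute)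
        finally have "norm x / d - norm x * (1 / (2 * d)) \<le> x \<bullet> v"
          using j[of t] by (simp add: u_def a)
        moreover have "norm x / d - norm x * (1 / (2 * d)) = norm x / (2 * d)"
          using d by (simp add: field_simps)
        moreover have "1 / 2 / (2 * d) < norm x / (2 * d)"
          using False d by (intro divide_strict_right_mono) auto
        ultimately have "1 / (4 * d) < x \<bullet> v" by simp
        moreover have "0 < 1 / (4 * d)" using d by simp
        ultimately have "\<epsilon> * real K < x \<bullet> v" "0 < x \<bullet> v" using \<epsilon>K by (blast intro: less_trans)+
        then have "\<epsilon> * real K < 2 * (x \<bullet> v)" by linarith
        then have "\<epsilon> * (\<epsilon> * real K) < \<epsilon> * (2 * (x \<bullet> v))" using \<epsilon> by simp
        moreover have "(norm (x - \<epsilon> *\<^sub>R v))\<^sup>2 = (norm x)\<^sup>2 - \<epsilon> * (2 * (x \<bullet> v)) + \<epsilon> * (\<epsilon> * (norm v)\<^sup>2)"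
          by (simp add: power2_norm_eq_inner inner_diff_left inner_diff_right inner_commute algebra_simps)
        ultimately have "(norm (x - \<epsilon> *\<^sub>R v))\<^sup>2 \<le> (norm x)\<^sup>2" by (simp add: nv norm_base)
        then show ?thesis using power2_le_imp_le[of "norm (x - \<epsilon> *\<^sub>R v)" "norm x"] by simp
      qed
      then show ?thesis using B x by (auto simp: v_def)
    qed
    then have "range (\<lambda>t. Some (j, \<sigma>, \<kappa>, t)) \<subseteq> {i. i \<noteq> None \<and> x - \<epsilon> *\<^sub>R rot (P i) base \<in> B}" by auto
    then have "card (range (\<lambda>t::bool \<times> bool. Some (j, \<sigma>, \<kappa>, t))) \<le>
        card {i. i \<noteq> None \<and> x - \<epsilon> *\<^sub>R rot (P i) base \<in> B}" by (intro card_mono) auto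
    moreover have "card (range (\<lambda>t::bool \<times> bool. Some (j, \<sigma>, \<kappa>, t))) = 4"
      by (subst card_image) (auto simp: inj_on_def card_prod)
    ultimately show "4 \<le> card {i. i \<noteq> None \<and> x - \<epsilon> *\<^sub>R rot (P i) base \<in> B}" by simp
  qed
  then show ?thesis by (simp add: card_prod card_option mult.commute)
qed

end

theorem theorem1p4:
  fixes B :: "(real ^ 'n) set"
  assumes "CARD('n) \<ge> 10"
    and "B = ball 0 1 \<or> B = cball 0 1"
  shows "(\<exists>m\<ge>2. divisible_into m B) \<and> CARD('n) < \<tau> B \<and> \<tau> B < 20 * CARD('n)"
proof -
  let ?m = "16 * CARD('n) + 1"
  have "9 \<le> CARD('n)" using assms(1) by simp
  then obtain pos :: "'n \<Rightarrow> nat \<times> nat" and im K where "block_chart pos im K"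
    using exists_block_chart by blast
  then have m: "2 \<le> ?m \<and> divisible_into ?m B"
    using block_chart.divisible_into_16_dim_plus_1[OF _ assms(2)] assms(1) by simp
  have "\<tau> B \<le> ?m" unfolding division_number_def using m by (rule Least_le)
  moreover have min: "2 \<le> \<tau> B \<and> divisible_into (\<tau> B) B"
    unfolding division_number_def using m by (rule LeastI)
  moreover have "CARD('n) < \<tau> B"
  proof (rule ccontr)
    assume "\<not> ?thesis"
    then have "\<not> divisible_into (\<tau> B) B"
      using min assms(2) by (intro not_divisible_into_few) auto
    then show False using min by blast
  qed
  ultimately show ?thesis using m assms(1) by (intro conjI exI[of _ ?m]) simp_all
qed

end
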